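(* Let $L,M\in\mathbb R_{>0}$, and let $\mathcal R:\mathcal B_L\times\mathcal B_M\to\mathcal B_M\times\mathcal B_L$ be the tropical R map $\mathcal R(l,m)=(l',m')$ given by $$l'_i=m_i\frac{P_i(l,m)}{P_{i-1}(l,m)},\qquad m'_i=l_i\frac{P_{i-1}(l,m)}{P_i(l,m)},\qquad P_i(l,m)=\sum_{k=1}^{n+1}\ \prod_{j=k}^{n+1}l_{i+j}\ \prod_{j=1}^{k}m_{i+j}$$ (indices modulo $n+1$). Then $\mathcal R$ is the unique tropical R map from $\mathcal B_L\times\mathcal B_M$ to $\mathcal B_M\times\mathcal B_L$; i.e. every tropical R map $\mathcal R':\mathcal B_L\times\mathcal B_M\to\mathcal B_M\times\mathcal B_L$ equals $\mathcal R$ as a birational map.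
   Context: For $L\in\mathbb R_{>0}$ put $\mathcal B_L=\{l=(l_1,\dots,l_{n+1})\in(\mathbb C^\times)^{n+1}\mid l_1l_2\cdots l_{n+1}=L\}$, with indices read modulo $n+1$. It carries the geometric crystal structure of affine type $A^{(1)}_n$ with index set $\{0,1,\dots,n\}$: $e_i^c(l)=(\dots,c\,l_i,c^{-1}l_{i+1},\dots)$ (all other coordinates unchanged; for $i=0$, $l_{n+1}\mapsto c\,l_{n+1}$ and $l_1\mapsto c^{-1}l_1$), $\gamma_i(l)=l_i/l_{i+1}$, $\varepsilon_i(l)=l_{i+1}$, for $i=0,1,\dots,n$. Product structure on $X\times Y$ for geometric crystals $X,Y$: $\gamma_i(x,y)=\gamma^X_i(x)\gamma^Y_i(y)$, $\varepsilon_i(x,y)=\varepsilon^X_i(x)+\varepsilon^Y_i(y)/\gamma^X_i(x)$, and $e_i^c(x,y)=(e_i^{c_1}(x),e_i^{c_2}(y))$ with $c_1=\frac{c\,\gamma^X_i(x)\varepsilon^X_i(x)+\varepsilon^Y_i(y)}{\gamma^X_i(x)\varepsilon^X_i(x)+\varepsilon^Y_i(y)}$, $c_2=c/c_1$. Tropical R maps on the family $\{\mathcal B_L\}_{L\in\mathbb R_{>0}}$ are birational maps $\mathcal R_{LM}:\mathcal B_L\times\mathcal B_M\to\mathcal B_M\times\mathcal B_L$ such that for all $i\in\{0,1,\dots,n\}$ and all $L,M,N$: $e_i^c\circ\mathcal R_{LM}=\mathcal R_{LM}\circ e_i^c$; $\varepsilon_i^{\mathcal B_L\times\mathcal B_M}=\varepsilon_i^{\mathcal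 B_M\times\mathcal B_L}\circ\mathcal R_{LM}$; $\gamma_i^{\mathcal B_L\times\mathcal B_M}=\gamma_i^{\mathcal B_M\times\mathcal B_L}\circ\mathcal R_{LM}$; and the Yang–Baxter equation $(\mathcal R_{MN}\times\mathrm{id})(\mathrm{id}\times\mathcal R_{LN})(\mathcal R_{LM}\times\mathrm{id})=(\mathrm{id}\times\mathcal R_{LM})(\mathcal R_{LN}\times\mathrm{id})(\mathrm{id}\times\mathcal R_{MN})$ holds on $\mathcal B_L\times\mathcal B_M\times\mathcal B_N$. A tropical R map $\mathcal B_L\times\mathcal B_M\to\mathcal B_M\times\mathcal B_L$ is a member of such a family. It is a previously known fact that the maps given by the explicit formula in the claim are tropical R maps. *)

theory Defs
  imports Complex_Main "HOL-Number_Theory.Cong"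
begin

section \<open>Rational maps between embedded complex varieties\<close>

text \<open>
  A variety is a set of points together with the coordinate functions that embed it into an affine
  space. Only irreducible varieties (tori and products of tori) occur below.
\<close>

record 'a variety =
  points :: "'a set"
  coords :: "('a \<Rightarrow> complex) set"

inductive_set poly_funs :: "('a, 'z) variety_scheme \<Rightarrow> ('a \<Rightarrow> complex) set"
  for X :: "('a, 'z) variety_scheme" where
  const: "(\<lambda>_. a) \<in> poly_funs X"
| coord: "f \<in> coords X \<Longrightarrow> f \<in> poly_funs X"
| add: "f \<in> poly_funs X \<Longrightarrow> g \<in> poly_funs X \<Longrightarrow> (\<lambda>x. f x + g x) \<in> poly_funs X"
| mult: "f \<in> poly_funs X \<Longrightarrow> g \<in> poly_funs X \<Longrightarrow> (\<lambda>x. f x * g x) \<in> poly_funs X"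

definition zariski_open :: "('a, 'z) variety_scheme \<Rightarrow> 'a set \<Rightarrow> bool" where
  "zariski_open X U \<longleftrightarrow> (\<exists>S \<subseteq> poly_funs X. U = {x \<in> points X. \<exists>g\<in>S. g x \<noteq> 0})"

definition generically :: "('a, 'z) variety_scheme \<Rightarrow> ('a \<Rightarrow> bool) \<Rightarrow> bool" where
  "generically X P \<longleftrightarrow> (\<exists>U. zariski_open X U \<and> U \<noteq> {} \<and> (\<forall>x\<in>U. P x))"

text \<open>
  A rational function or map is represented by a total HOL function whose values outside some
  nonempty Zariski open set are irrelevant. Two representatives give the same rational
  map iff they agree on a nonempty (hence, by irreducibility, dense) Zariski open set.
\<close>

definition rational_eq :: "('a, 'z) variety_scheme \<Rightarrow> ('a \<Rightarrow> 'b) \<Rightarrow> ('a \<Rightarrow> 'b) \<Rightarrow> bool" where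
  "rational_eq X F G \<longleftrightarrow> generically X (\<lambda>x. F x = G x)"

definition rational_fun :: "('a, 'z) variety_scheme \<Rightarrow> ('a \<Rightarrow> complex) \<Rightarrow> bool" where
  "rational_fun X \<phi> \<longleftrightarrow>
     (\<exists>f\<in>poly_funs X. \<exists>g\<in>poly_funs X. generically X (\<lambda>x. g x \<noteq> 0 \<and> \<phi> x = f x / g x))"

definition rational_map ::
  "('a, 'y) variety_scheme \<Rightarrow> ('b, 'z) variety_scheme \<Rightarrow> ('a \<Rightarrow> 'b) \<Rightarrow> bool" where
  "rational_map X Y F \<longleftrightarrow>
     generically X (\<lambda>x. F x \<in> points Y) \<and> (\<forall>\<phi>\<in>coords Y. rational_fun X (\<phi> \<circ> F))"

text \<open>
  Dominance makes the composite of representatives a representative of the composite rational map,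
  independently of the choice of representatives.
\<close>

definition dominant ::
  "('a, 'y) variety_scheme \<Rightarrow> ('b, 'z) variety_scheme \<Rightarrow> ('a \<Rightarrow> 'b) \<Rightarrow> bool" where
  "dominant X Y F \<longleftrightarrow>
     (\<forall>V. zariski_open Y V \<and> V \<noteq> {} \<longrightarrow> generically X (\<lambda>x. F x \<in> V))"

definition birational_map ::
  "('a, 'y) variety_scheme \<Rightarrow> ('b, 'z) variety_scheme \<Rightarrow> ('a \<Rightarrow> 'b) \<Rightarrow> bool" where
  "birational_map X Y F \<longleftrightarrow>
     rational_map X Y F \<and> dominant X Y F \<and>
     (\<exists>G. rational_map Y X G \<and> dominant Y X G \<and>
        rational_eq X (G \<circ> F) id \<and> rational_eq Y (F \<circ> G) id)"


section \<open>Geometric crystals and their products\<close>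

record 'a geom_crystal = "'a variety" +
  act :: "int \<Rightarrow> complex \<Rightarrow> 'a \<Rightarrow> 'a"  \<comment> \<open>\<open>act X i c\<close> is $e_i^c$\<close>
  gam :: "int \<Rightarrow> 'a \<Rightarrow> complex"
  eps :: "int \<Rightarrow> 'a \<Rightarrow> complex"

definition prod_act ::
  "'a geom_crystal \<Rightarrow> 'b geom_crystal \<Rightarrow> int \<Rightarrow> complex \<Rightarrow> 'a \<times> 'b \<Rightarrow> 'a \<times> 'b" where
  "prod_act X Y i c = (\<lambda>(x, y).
     let c1 = (c * gam X i x * eps X i x + eps Y i y) / (gam X i x * eps X i x + eps Y i y);
         c2 = c / c1
     in (act X i c1 x, act Y i c2 y))"

definition crystal_prod ::
  "'a geom_crystal \<Rightarrow> 'b geom_crystal \<Rightarrow> ('a \<times> 'b) geom_crystal" (infixr "\<otimes>" 70) where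
  "X \<otimes> Y =
     \<lparr> points = points X \<times> points Y,
       coords = {f \<circ> fst | f. f \<in> coords X} \<union> {g \<circ> snd | g. g \<in> coords Y},
       act = prod_act X Y,
       gam = (\<lambda>i (x, y). gam X i x * gam Y i y),
       eps = (\<lambda>i (x, y). eps X i x + eps Y i y / gam X i x) \<rparr>"

text \<open>
  A tuple \<open>(l\<^sub>1, \<dots>, l\<^sub>n\<^sub>+\<^sub>1)\<close> with indices read modulo \<open>n + 1\<close> is encoded as an
  \<open>(n + 1)\<close>-periodic function on the integers.
\<close>

definition B_points :: "nat \<Rightarrow> real \<Rightarrow> (int \<Rightarrow> complex) set" where
  "B_points n L = {l. (\<forall>i. l (i + (int n + 1)) = l i) \<and> (\<forall>i. l i \<noteq> 0) \<and>
     (\<Prod>i = 1..int n + 1. l i) = of_real L}"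

definition B_act :: "nat \<Rightarrow> int \<Rightarrow> complex \<Rightarrow> (int \<Rightarrow> complex) \<Rightarrow> (int \<Rightarrow> complex)" where
  "B_act n i c l = (\<lambda>j. if [j = i] (mod (int n + 1)) then c * l j
                        else if [j = i + 1] (mod (int n + 1)) then inverse c * l j
                        else l j)"

definition B :: "nat \<Rightarrow> real \<Rightarrow> (int \<Rightarrow> complex) geom_crystal" where
  "B n L =
     \<lparr> points = B_points n L,
       coords = {\<lambda>l. l i | i. True},
       act = B_act n,
       gam = (\<lambda>i l. l i / l (i + 1)),
       eps = (\<lambda>i l. l (i + 1)) \<rparr>"


section \<open>Tropical R maps\<close>

definition crystal_compatible ::
  "nat \<Rightarrow> 'a geom_crystal \<Rightarrow> 'b geom_crystal \<Rightarrow> ('a \<Rightarrow> 'b) \<Rightarrow> bool" where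
  "crystal_compatible n X Y F \<longleftrightarrow>
     (\<forall>i\<in>{0..int n}.
        (\<forall>c. c \<noteq> 0 \<longrightarrow> rational_eq X (act Y i c \<circ> F) (F \<circ> act X i c)) \<and>
        rational_eq X (eps X i) (eps Y i \<circ> F) \<and>
        rational_eq X (gam X i) (gam Y i \<circ> F))"

definition times_id :: "('a \<times> 'a \<Rightarrow> 'a \<times> 'a) \<Rightarrow> 'a \<times> 'a \<times> 'a \<Rightarrow> 'a \<times> 'a \<times> 'a" where
  "times_id F = (\<lambda>(x, y, z). let (x', y') = F (x, y) in (x', y', z))"

definition id_times :: "('a \<times> 'a \<Rightarrow> 'a \<times> 'a) \<Rightarrow> 'a \<times> 'a \<times> 'a \<Rightarrow> 'a \<times> 'a \<times> 'a" where
  "id_times F = (\<lambda>(x, y, z). (x, F (y, z)))"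

type_synonym pair_map =
  "(int \<Rightarrow> complex) \<times> (int \<Rightarrow> complex) \<Rightarrow> (int \<Rightarrow> complex) \<times> (int \<Rightarrow> complex)"

definition tropical_R_family :: "nat \<Rightarrow> (real \<Rightarrow> real \<Rightarrow> pair_map) \<Rightarrow> bool" where
  "tropical_R_family n R \<longleftrightarrow>
     (\<forall>L>0. \<forall>M>0.
        birational_map (B n L \<otimes> B n M) (B n M \<otimes> B n L) (R L M) \<and>
        crystal_compatible n (B n L \<otimes> B n M) (B n M \<otimes> B n L) (R L M)) \<and>
     (\<forall>L>0. \<forall>M>0. \<forall>N>0.
        rational_eq (B n L \<otimes> B n M \<otimes> B n N)
          (times_id (R M N) \<circ> id_times (R L N) \<circ> times_id (R L M))
          (id_times (R L M) \<circ> times_id (R L N) \<circ> id_times (R M N)))"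

definition tropical_R_map :: "nat \<Rightarrow> real \<Rightarrow> real \<Rightarrow> pair_map \<Rightarrow> bool" where
  "tropical_R_map n L M F \<longleftrightarrow> (\<exists>R. tropical_R_family n R \<and> R L M = F)"

definition P_poly :: "nat \<Rightarrow> (int \<Rightarrow> complex) \<Rightarrow> (int \<Rightarrow> complex) \<Rightarrow> int \<Rightarrow> complex" where
  "P_poly n l m i =
     (\<Sum>k = 1..int n + 1. (\<Prod>j = k..int n + 1. l (i + j)) * (\<Prod>j = 1..k. m (i + j)))"

text \<open>The same formula serves every pair \<open>(L, M)\<close>.\<close>

definition R_explicit :: "nat \<Rightarrow> pair_map" where
  "R_explicit n = (\<lambda>(l, m).
     (\<lambda>i. m i * (P_poly n l m i / P_poly n l m (i - 1)),
      \<lambda>i. l i * (P_poly n l m (i - 1) / P_poly n l m i)))"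

end

theory Submission
  imports Defs "HOL-Complex_Analysis.Conformal_Mappings"
begin

text \<open>
  Write \<open>N = n + 1\<close>, let \<open>(l, m)\<close> be a pair with products \<open>L\<close> and \<open>M\<close>, and put \<open>P\<^sub>i = P_poly n l m i\<close>.
  Everything rests on two facts about first-order recurrences with periodic coefficients:
  \<open>m\<^sub>i P\<^sub>i - l\<^sub>i P\<^sub>i\<^sub>-\<^sub>1 = (M - L) l\<^sub>i m\<^sub>i\<close> (\<open>P_poly_recurrence\<close>), and conversely
  every periodic \<open>Q\<close> with \<open>m\<^sub>i Q\<^sub>i - l\<^sub>i Q\<^sub>i\<^sub>-\<^sub>1 = c l\<^sub>i m\<^sub>i\<close> satisfies
  \<open>(M - L) Q\<^sub>i = c P\<^sub>i\<close> (\<open>P_poly_telescope\<close>).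

  The structure functions \<open>\<gamma>\<^sub>i\<close> and \<open>\<epsilon>\<^sub>i\<close> of a pair are expressions in the numbers \<open>l\<^sub>i m\<^sub>i\<close> and
  \<open>1/l\<^sub>i + 1/m\<^sub>i\<^sub>+\<^sub>1\<close>. The recurrence shows that the explicit map preserves these numbers. If another
  pair \<open>(l', m')\<close> with products \<open>M\<close> and \<open>L\<close> has the same numbers and \<open>l' \<noteq> l\<close>, then
  \<open>Q\<^sub>i\<^sub>-\<^sub>1 = l\<^sub>i m\<^sub>i / (l'\<^sub>i - l\<^sub>i)\<close> solves the recurrence with \<open>c = 1\<close>; so \<open>(M - L) Q = P\<close>, which
  determines \<open>(l', m')\<close>. Hence the explicit map is characterised by its invariants
  (\<open>R_explicit_unique\<close>). The claims build on this as follows.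

  Birationality: the explicit map leaves \<open>P\<close> unchanged and is an involution where \<open>P\<close> does not vanish.
  Compatibility with \<open>e\<^sub>i\<^sup>c\<close>: the invariants of \<open>e\<^sub>i\<^sup>c(x)\<close> are functions of those of \<open>x\<close> and of \<open>c\<close>
  (\<open>act_invariants\<close>), so \<open>e\<^sub>i\<^sup>c(R x)\<close> has the invariants that characterise \<open>R(e\<^sub>i\<^sup>c x)\<close>.

  Yang-Baxter equation: let \<open>lax l\<close> be the difference operator \<open>f \<mapsto> (f\<^sub>i / l\<^sub>i + f\<^sub>i\<^sub>+\<^sub>1)\<^sub>i\<close>.
  Preserving the invariants means \<open>lax l \<circ> lax m = lax l' \<circ> lax m'\<close>, so both sides of the equation
  factor the same third-order operator into factors of prescribed products. For distinct products
  such a factorisation is unique, because the kernels of the factors consist of quasi-periodic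
  sequences with distinct multipliers (\<open>lax_triple_unique\<close>). When two of the products agree, the
  equation reduces to the facts that the explicit map is the identity for equal products and an
  involution in general.

  Uniqueness: a crystal morphism \<open>F\<close> preserves \<open>\<epsilon>\<^sub>i\<close> for every \<open>i\<close>, and preserving all \<open>\<gamma>\<^sub>i\<close> fixes
  \<open>l\<^sub>i m\<^sub>i\<close> up to a common factor, a priori any \<open>N\<close>-th root of unity. The factor is \<open>1\<close>
  because \<open>c \<mapsto> \<epsilon>\<^sub>0(e\<^sub>1\<^sup>c x)\<close> is a quadratic polynomial whose constant term is
  \<open>l\<^sub>2 m\<^sub>2 / \<epsilon>\<^sub>1(x)\<close> (\<open>product_from_eps\<close>). So \<open>F\<close> preserves the invariants and equals the
  explicit map.

  All of this holds at generic points. Generic properties can be intersected because any two points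
  of the varieties in question lie on an entire curve (\<open>generically_conj\<close>), and existence of good
  points is seen on positive real sequences.
\<close>

section \<open>Generic points of varieties connected by entire curves\<close>

text \<open>
  A property that holds on some Zariski open neighbourhood of \<open>x0\<close>. Neighbourhoods of a fixed point
  are closed under intersection on every variety, whereas two arbitrary nonempty open sets are
  guaranteed to meet only on an irreducible one.
\<close>

definition near :: "('a, 'z) variety_scheme \<Rightarrow> 'a \<Rightarrow> ('a \<Rightarrow> bool) \<Rightarrow> bool" where
  "near X x0 P \<longleftrightarrow> (\<exists>g\<in>poly_funs X. g x0 \<noteq> 0 \<and> (\<forall>x\<in>points X. g x \<noteq> 0 \<longrightarrow> P x))"

lemma near_conj: "near X x0 P \<Longrightarrow> near X x0 Q \<Longrightarrow> near X x0 (\<lambda>x. P x \<and> Q x)"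
  unfolding near_def
proof (elim bexE conjE)
  fix f g
  assume *: "f \<in> poly_funs X" "f x0 \<noteq> 0" "\<forall>x\<in>points X. f x \<noteq> 0 \<longrightarrow> P x"
    "g \<in> poly_funs X" "g x0 \<noteq> 0" "\<forall>x\<in>points X. g x \<noteq> 0 \<longrightarrow> Q x"
  show "\<exists>g\<in>poly_funs X. g x0 \<noteq> 0 \<and> (\<forall>x\<in>points X. g x \<noteq> 0 \<longrightarrow> P x \<and> Q x)"
    by (rule bexI[of _ "\<lambda>x. f x * g x"]) (use * in \<open>auto intro: poly_funs.mult\<close>)
qed

lemma near_mono: "near X x0 P \<Longrightarrow> (\<And>x. x \<in> points X \<Longrightarrow> P x \<Longrightarrow> Q x) \<Longrightarrow> near X x0 Q"
  unfolding near_def by blast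

lemma near_points: "(\<And>x. x \<in> points X \<Longrightarrow> P x) \<Longrightarrow> near X x0 P"
  unfolding near_def by (rule bexI[of _ "\<lambda>_. 1"]) (auto intro: poly_funs.const)

lemma near_ball_finite:
  assumes "finite A" "\<And>a. a \<in> A \<Longrightarrow> near X x0 (P a)"
  shows "near X x0 (\<lambda>x. \<forall>a\<in>A. P a x)"
  using assms
proof (induction A)
  case empty
  show ?case by (rule near_points) simp
next
  case (insert a A)
  then have "near X x0 (\<lambda>x. P a x \<and> (\<forall>a\<in>A. P a x))"
    by (intro near_conj) auto
  then show ?case by (rule near_mono) auto
qed

lemma generically_iff_near: "generically X P \<longleftrightarrow> (\<exists>x0\<in>points X. near X x0 P)"
proof
  assume "generically X P"
  then obtain S where S: "S \<subseteq> poly_funs X" "{x \<in> points X. \<exists>g\<in>S. g x \<noteq> 0} \<noteq> {}"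
    "\<forall>x\<in>{x \<in> points X. \<exists>g\<in>S. g x \<noteq> 0}. P x"
    unfolding generically_def zariski_open_def by blast
  then obtain x0 g where "x0 \<in> points X" "g \<in> S" "g x0 \<noteq> 0" by blast
  with S show "\<exists>x0\<in>points X. near X x0 P" unfolding near_def by blast
next
  assume "\<exists>x0\<in>points X. near X x0 P"
  then obtain x0 g where *: "x0 \<in> points X" "g \<in> poly_funs X" "g x0 \<noteq> 0"
    "\<forall>x\<in>points X. g x \<noteq> 0 \<longrightarrow> P x" unfolding near_def by blast
  have "zariski_open X {x \<in> points X. \<exists>h\<in>{g}. h x \<noteq> 0}"
    unfolding zariski_open_def using * by blast
  with * show "generically X P" unfolding generically_def by blast
qed

lemma generically_mono:
  "generically X P \<Longrightarrow> (\<And>x. x \<in> points X \<Longrightarrow> P x \<Longrightarrow> Q x) \<Longrightarrow> generically X Q"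
  unfolding generically_iff_near by (meson near_mono)

lemma generically_dominant:
  assumes "dominant X Y F" "generically Y P"
  shows "generically X (\<lambda>x. P (F x))"
proof -
  obtain V where V: "zariski_open Y V" "V \<noteq> {}" "\<forall>y\<in>V. P y"
    using assms(2) unfolding generically_def by blast
  then have "generically X (\<lambda>x. F x \<in> V)" using assms(1) unfolding dominant_def by blast
  then show ?thesis by (rule generically_mono) (use V in blast)
qed

text \<open>
  An analytic substitute for irreducibility that is easy to check for tori and products. Entire curves,
  unlike algebraic ones, can be taken to be exponentials that stay inside the torus for all parameters.
\<close>

definition curve_connected :: "('a, 'z) variety_scheme \<Rightarrow> bool" where
  "curve_connected X \<longleftrightarrow> (\<forall>x\<in>points X. \<forall>y\<in>points X. \<exists>\<gamma> :: complex \<Rightarrow> 'a.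
     \<gamma> 0 = x \<and> \<gamma> 1 = y \<and> (\<forall>t. \<gamma> t \<in> points X) \<and>
     (\<forall>\<phi>\<in>coords X. (\<lambda>t. \<phi> (\<gamma> t)) holomorphic_on UNIV))"

lemma holomorphic_poly_curve:
  assumes "\<forall>\<phi>\<in>coords X. (\<lambda>t. \<phi> (\<gamma> t)) holomorphic_on UNIV" "f \<in> poly_funs X"
  shows "(\<lambda>t. f (\<gamma> t)) holomorphic_on UNIV"
  using assms(2,1) by induction (auto intro!: holomorphic_intros)

text \<open>
  Restrict the two witnessing functions to an entire curve through their nonvanishing points: if
  their product vanished along the curve, the second would vanish on the open set where the first does
  not, hence everywhere by analytic continuation.
\<close>

lemma generically_conj:
  assumes X: "curve_connected X" and P: "generically X P" and Q: "generically X Q"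
  shows "generically X (\<lambda>x. P x \<and> Q x)"
proof -
  obtain x f where f: "x \<in> points X" "f \<in> poly_funs X" "f x \<noteq> 0"
    "\<forall>x\<in>points X. f x \<noteq> 0 \<longrightarrow> P x"
    using P unfolding generically_iff_near near_def by blast
  obtain y g where g: "y \<in> points X" "g \<in> poly_funs X" "g y \<noteq> 0"
    "\<forall>x\<in>points X. g x \<noteq> 0 \<longrightarrow> Q x"
    using Q unfolding generically_iff_near near_def by blast
  obtain \<gamma> :: "complex \<Rightarrow> 'a" where \<gamma>: "\<gamma> 0 = x" "\<gamma> 1 = y" "\<forall>t. \<gamma> t \<in> points X"
    "\<forall>\<phi>\<in>coords X. (\<lambda>t. \<phi> (\<gamma> t)) holomorphic_on UNIV"
    using X f(1) g(1) unfolding curve_connected_def by blast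
  have hf: "(\<lambda>t. f (\<gamma> t)) holomorphic_on UNIV" and hg: "(\<lambda>t. g (\<gamma> t)) holomorphic_on UNIV"
    using holomorphic_poly_curve[OF \<gamma>(4)] f g by blast+
  have "\<exists>t. f (\<gamma> t) \<noteq> 0 \<and> g (\<gamma> t) \<noteq> 0"
  proof (rule ccontr)
    assume "\<nexists>t. f (\<gamma> t) \<noteq> 0 \<and> g (\<gamma> t) \<noteq> 0"
    then have *: "g (\<gamma> t) = 0" if "f (\<gamma> t) \<noteq> 0" for t using that by blast
    have "open {t. f (\<gamma> t) \<noteq> 0}"
      using holomorphic_on_imp_continuous_on[OF hf] by (intro open_Collect_neq) auto
    moreover have "0 \<in> {t. f (\<gamma> t) \<noteq> 0}" using f \<gamma> by simp
    ultimately have "g (\<gamma> 1) = 0"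
      using analytic_continuation_open[of "{t. f (\<gamma> t) \<noteq> 0}" UNIV "\<lambda>t. g (\<gamma> t)" "\<lambda>_. 0" 1] hg *
      by auto
    then show False using g \<gamma> by simp
  qed
  then obtain t where "f (\<gamma> t) \<noteq> 0" "g (\<gamma> t) \<noteq> 0" by blast
  then show ?thesis unfolding generically_iff_near near_def
    by (intro bexI[of _ "\<gamma> t"] bexI[of _ "\<lambda>x. f x * g x"])
       (use f g \<gamma> in \<open>auto intro: poly_funs.mult\<close>)
qed

lemma generically_ball_finite:
  assumes "curve_connected X" "finite A" "A \<noteq> {}" "\<And>a. a \<in> A \<Longrightarrow> generically X (P a)"
  shows "generically X (\<lambda>x. \<forall>a\<in>A. P a x)"
  using assms(2-)
proof (induction A rule: finite_ne_induct)
  case (singleton a)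
  then show ?case by simp
next
  case (insert a A)
  then have "generically X (\<lambda>x. P a x \<and> (\<forall>a\<in>A. P a x))"
    by (intro generically_conj assms(1)) auto
  then show ?case by (rule generically_mono) auto
qed

section \<open>Functions and maps regular at a point\<close>

text \<open>
  Membership in the local ring of \<open>X\<close> at \<open>x0\<close>.
\<close>

definition reg_at :: "('a, 'z) variety_scheme \<Rightarrow> 'a \<Rightarrow> ('a \<Rightarrow> complex) \<Rightarrow> bool" where
  "reg_at X x0 \<phi> \<longleftrightarrow> (\<exists>f\<in>poly_funs X. \<exists>g\<in>poly_funs X. g x0 \<noteq> 0 \<and>
     (\<forall>x\<in>points X. g x \<noteq> 0 \<longrightarrow> \<phi> x = f x / g x))"

lemma reg_at_poly: "f \<in> poly_funs X \<Longrightarrow> reg_at X x0 f"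
  unfolding reg_at_def
  by (rule bexI[of _ f], rule bexI[of _ "\<lambda>_. 1"]) (auto intro: poly_funs.const)

lemma reg_at_const: "reg_at X x0 (\<lambda>_. a)"
  by (intro reg_at_poly poly_funs.const)

lemma reg_at_add: 
  assumes "reg_at X x0 \<phi>" "reg_at X x0 \<psi>" shows "reg_at X x0 (\<lambda>x. \<phi> x + \<psi> x)"
proof -
  obtain f g where 1: "f \<in> poly_funs X" "g \<in> poly_funs X" "g x0 \<noteq> 0"
     "\<forall>x\<in>points X. g x \<noteq> 0 \<longrightarrow> \<phi> x = f x / g x" using assms(1) unfolding reg_at_def by blast
  obtain p q where 2: "p \<in> poly_funs X" "q \<in> poly_funs X" "q x0 \<noteq> 0"
     "\<forall>x\<in>points X. q x \<noteq> 0 \<longrightarrow> \<psi> x = p x / q x" using assms(2) unfolding reg_at_def by blast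
  show ?thesis unfolding reg_at_def
    by (rule bexI[of _ "\<lambda>x. f x * q x + p x * g x"], rule bexI[of _ "\<lambda>x. g x * q x"])
       (use 1 2 in \<open>auto intro: poly_funs.add poly_funs.mult simp: add_frac_eq\<close>)
qed

lemma reg_at_mult: 
  assumes "reg_at X x0 \<phi>" "reg_at X x0 \<psi>" shows "reg_at X x0 (\<lambda>x. \<phi> x * \<psi> x)"
proof -
  obtain f g where 1: "f \<in> poly_funs X" "g \<in> poly_funs X" "g x0 \<noteq> 0"
     "\<forall>x\<in>points X. g x \<noteq> 0 \<longrightarrow> \<phi> x = f x / g x" using assms(1) unfolding reg_at_def by blast
  obtain p q where 2: "p \<in> poly_funs X" "q \<in> poly_funs X" "q x0 \<noteq> 0"
     "\<forall>x\<in>points X. q x \<noteq> 0 \<longrightarrow> \<psi> x = p x / q x" using assms(2) unfolding reg_at_def by blast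
  show ?thesis unfolding reg_at_def
    by (rule bexI[of _ "\<lambda>x. f x * p x"], rule bexI[of _ "\<lambda>x. g x * q x"])
       (use 1 2 in \<open>auto intro: poly_funs.add poly_funs.mult\<close>)
qed

lemma near_nonzero:
  assumes "reg_at X x0 \<phi>" "\<phi> x0 \<noteq> 0" "x0 \<in> points X" shows "near X x0 (\<lambda>x. \<phi> x \<noteq> 0)"
proof -
  obtain f g where 1: "f \<in> poly_funs X" "g \<in> poly_funs X" "g x0 \<noteq> 0"
     "\<forall>x\<in>points X. g x \<noteq> 0 \<longrightarrow> \<phi> x = f x / g x" using assms(1) unfolding reg_at_def by blast
  show ?thesis unfolding near_def
    by (rule bexI[of _ "\<lambda>x. f x * g x"]) (use 1 assms in \<open>auto intro: poly_funs.mult\<close>)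
qed

lemma reg_at_divide: 
  assumes "reg_at X x0 \<phi>" "reg_at X x0 \<psi>" "\<psi> x0 \<noteq> 0" "x0 \<in> points X"
  shows "reg_at X x0 (\<lambda>x. \<phi> x / \<psi> x)"
proof -
  obtain p q where 2: "p \<in> poly_funs X" "q \<in> poly_funs X" "q x0 \<noteq> 0"
     "\<forall>x\<in>points X. q x \<noteq> 0 \<longrightarrow> \<psi> x = p x / q x" using assms(2) unfolding reg_at_def by blast
  then have p: "p x0 \<noteq> 0" using assms by auto
  \<comment> \<open>For \<open>\<psi> = p / q\<close> the denominator is \<open>p q\<close>, not \<open>p\<close>: nothing is known about \<open>\<psi>\<close> where \<open>q\<close> vanishes.\<close>
  have "reg_at X x0 (\<lambda>x. 1 / \<psi> x)" unfolding reg_at_def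
    by (rule bexI[of _ "\<lambda>x. q x * q x"], rule bexI[of _ "\<lambda>x. p x * q x"])
       (use 2 p in \<open>auto intro: poly_funs.mult\<close>)
  from reg_at_mult[OF assms(1) this] show ?thesis by simp
qed

lemma reg_at_sum:
  assumes "\<And>a. a \<in> A \<Longrightarrow> reg_at X x0 (f a)"
  shows "reg_at X x0 (\<lambda>x. \<Sum>a\<in>A. f a x)"
  using assms
  by (induction A rule: infinite_finite_induct) (auto intro: reg_at_const reg_at_add)

lemma reg_at_prod:
  assumes "\<And>a. a \<in> A \<Longrightarrow> reg_at X x0 (f a)"
  shows "reg_at X x0 (\<lambda>x. \<Prod>a\<in>A. f a x)"
  using assms
  by (induction A rule: infinite_finite_induct) (auto intro: reg_at_const reg_at_mult)

lemma reg_at_cong: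
  assumes "reg_at X x0 \<phi>" "near X x0 (\<lambda>x. \<phi> x = \<psi> x)"
  shows "reg_at X x0 \<psi>"
proof -
  obtain f g where 1: "f \<in> poly_funs X" "g \<in> poly_funs X" "g x0 \<noteq> 0"
     "\<forall>x\<in>points X. g x \<noteq> 0 \<longrightarrow> \<phi> x = f x / g x" using assms(1) unfolding reg_at_def by blast
  obtain h where 2: "h \<in> poly_funs X" "h x0 \<noteq> 0"
     "\<forall>x\<in>points X. h x \<noteq> 0 \<longrightarrow> \<phi> x = \<psi> x" using assms(2) unfolding near_def by blast
  show ?thesis unfolding reg_at_def
    by (rule bexI[of _ "\<lambda>x. f x * h x"], rule bexI[of _ "\<lambda>x. g x * h x"])
       (use 1 2 in \<open>auto intro: poly_funs.mult\<close>)
qed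

lemma reg_at_compose:
  assumes "g \<in> poly_funs Y" "\<forall>\<phi>\<in>coords Y. reg_at X x0 (\<lambda>x. \<phi> (F x))"
  shows "reg_at X x0 (\<lambda>x. g (F x))"
  using assms by induction (auto intro: reg_at_const reg_at_add reg_at_mult)

lemma rational_fun_reg_at:
  assumes "x0 \<in> points X" "reg_at X x0 \<phi>" shows "rational_fun X \<phi>"
proof -
  obtain f g where 1: "f \<in> poly_funs X" "g \<in> poly_funs X" "g x0 \<noteq> 0"
     "\<forall>x\<in>points X. g x \<noteq> 0 \<longrightarrow> \<phi> x = f x / g x" using assms(2) unfolding reg_at_def by blast
  have "generically X (\<lambda>x. g x \<noteq> 0 \<and> \<phi> x = f x / g x)"
    unfolding generically_iff_near near_def using 1 assms(1) by blast
  then show ?thesis unfolding rational_fun_def using 1 by blast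
qed

definition reg_map_at ::
  "('a, 'y) variety_scheme \<Rightarrow> ('b, 'z) variety_scheme \<Rightarrow> 'a \<Rightarrow> ('a \<Rightarrow> 'b) \<Rightarrow> bool" where
  "reg_map_at X Y x0 F \<longleftrightarrow>
     near X x0 (\<lambda>x. F x \<in> points Y) \<and> (\<forall>\<phi>\<in>coords Y. reg_at X x0 (\<lambda>x. \<phi> (F x)))"

lemma rational_map_reg_map_at:
  assumes "x0 \<in> points X" "reg_map_at X Y x0 F" shows "rational_map X Y F"
  using assms unfolding rational_map_def reg_map_at_def generically_iff_near
  by (auto simp: o_def intro: rational_fun_reg_at)

text \<open>
  An open set \<open>V\<close> meets the generic set \<open>W\<close>, and a point in the intersection lifts to some \<open>x\<close>. A
  polynomial that defines \<open>V\<close> pulls back to a function that is regular and nonzero at \<open>x\<close>, so it is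
  nonzero near \<open>x\<close>.
\<close>

lemma dominantI:
  assumes Y: "curve_connected Y" and W: "generically Y W"
    and sec: "\<And>y. y \<in> points Y \<Longrightarrow> W y \<Longrightarrow> \<exists>x\<in>points X. F x = y \<and> reg_map_at X Y x F"
  shows "dominant X Y F"
  unfolding dominant_def
proof (intro allI impI, elim conjE)
  fix V assume V: "zariski_open Y V" "V \<noteq> {}"
  then have "generically Y (\<lambda>y. y \<in> V)" unfolding generically_def by blast
  then have "generically Y (\<lambda>y. y \<in> V \<and> W y)" by (intro generically_conj Y W)
  then obtain y where y: "y \<in> V" "W y" unfolding generically_def by blast
  obtain S where S: "S \<subseteq> poly_funs Y" "V = {y \<in> points Y. \<exists>g\<in>S. g y \<noteq> 0}"
    using V unfolding zariski_open_def by blast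
  obtain g where g: "g \<in> S" "g y \<noteq> 0" using y S by blast
  obtain x where x: "x \<in> points X" "F x = y" "reg_map_at X Y x F" using sec y S by blast
  have "reg_at X x (\<lambda>x. g (F x))"
    using x g S by (intro reg_at_compose[of g Y]) (auto simp: reg_map_at_def)
  then have "near X x (\<lambda>x. g (F x) \<noteq> 0)" using g x by (intro near_nonzero) auto
  then have "near X x (\<lambda>x. F x \<in> points Y \<and> g (F x) \<noteq> 0)"
    using x by (intro near_conj) (auto simp: reg_map_at_def)
  then have "near X x (\<lambda>x. F x \<in> V)" by (rule near_mono) (use S g in auto)
  then show "generically X (\<lambda>x. F x \<in> V)" unfolding generically_iff_near using x by blast
qed

section \<open>Recurrence and telescoping for the polynomials P\<close>

definition periodic :: "nat \<Rightarrow> (int \<Rightarrow> complex) \<Rightarrow> bool" where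
  "periodic n l \<longleftrightarrow> (\<forall>i. l (i + (int n + 1)) = l i)"

lemma periodicD: "periodic n l \<Longrightarrow> l (i + (int n + 1)) = l i"
  by (simp add: periodic_def)

lemma periodic_mult: "periodic n l \<Longrightarrow> l (i + (int n + 1) * k) = l i"
proof (induction k arbitrary: i rule: int_induct[of _ 0])
  case base
  then show ?case by simp
next
  case (step1 k)
  have "l (i + (int n + 1) * (k + 1)) = l (i + (int n + 1) * k + (int n + 1))"
    by (simp add: algebra_simps)
  then show ?case using step1 by (simp only: periodicD)
next
  case (step2 k)
  have "l (i + (int n + 1) * (k - 1)) = l (i + (int n + 1) * (k - 1) + (int n + 1))"
    using step2.prems by (simp only: periodicD)
  also have "\<dots> = l (i + (int n + 1) * k)" by (simp add: algebra_simps)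
  finally show ?case using step2 by simp
qed

lemma periodic_cong: "periodic n l \<Longrightarrow> [i = j] (mod (int n + 1)) \<Longrightarrow> l i = l j"
  by (metis cong_iff_lin periodic_mult)

lemma prod_int_shift: "(\<Prod>j = a..b. l (i + j)) = (\<Prod>j = i + a..i + b. l j)" for a b i :: int
  by (rule prod.reindex_bij_witness[of _ "\<lambda>j. j - i" "\<lambda>j. i + j"]) auto

lemma prod_period_shift:
  assumes "periodic n l"
  shows "(\<Prod>j = 1..int n + 1. l (i + j)) = (\<Prod>j = 1..int n + 1. l j)"
proof -
  have step: "(\<Prod>j = 1..int n + 1. l (i + 1 + j)) = (\<Prod>j = 1..int n + 1. l (i + j))" for i
  proof -
    have 1: "{i + 1..i + (int n + 1)} = insert (i + 1) {i + 2..i + (int n + 1)}" by auto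
    have 2: "{i + 1 + 1..i + 1 + (int n + 1)} = insert (i + 1 + (int n + 1)) {i + 2..i + (int n + 1)}"
      by auto
    show ?thesis unfolding prod_int_shift 1 2 using periodicD[OF assms, of "i + 1"] by simp
  qed
  show ?thesis
  proof (induction i rule: int_induct[of _ 0])
    case (step2 i)
    then show ?case using step[of "i - 1"] by simp
  qed (use step in auto)
qed

lemma P_poly_periodic:
  assumes "periodic n l" "periodic n m" shows "periodic n (P_poly n l m)"
proof -
  have "l (i + (int n + 1) + j) = l (i + j)" "m (i + (int n + 1) + j) = m (i + j)" for i j
    using periodicD[OF assms(1), of "i + j"] periodicD[OF assms(2), of "i + j"]
    by (simp_all add: algebra_simps)
  then show ?thesis unfolding periodic_def P_poly_def by simp
qed

lemma sum_telescope_int: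
  "(\<Sum>k = 1..int p. (t k - t (k - 1) :: complex)) = t (int p) - t 0"
proof (induction p)
  case (Suc p)
  have "{1..int (Suc p)} = insert (int (Suc p)) {1..int p}" by auto
  then show ?case using Suc by simp
qed simp

lemma prod_int_head: "a \<le> b \<Longrightarrow> (\<Prod>j = a..b. f j) = f a * (\<Prod>j = a + 1..b. f j :: complex)" for a b :: int
proof -
  assume "a \<le> b"
  then have "{a..b} = insert a {a + 1..b}" by auto
  then show ?thesis by simp
qed

lemma prod_int_last: "a \<le> b \<Longrightarrow> (\<Prod>j = a..b. f j) = f b * (\<Prod>j = a..b - 1. f j :: complex)" for a b :: int
proof -
  assume "a \<le> b"
  then have "{a..b} = insert b {a..b - 1}" by auto
  then show ?thesis by simp
qed

text \<open>
  Multiplying the recurrence at \<open>i + k\<close> by \<open>l\<^sub>i\<^sub>+\<^sub>k\<^sub>+\<^sub>1 \<cdots> l\<^sub>i\<^sub>+\<^sub>N m\<^sub>i\<^sub>+\<^sub>1 \<cdots> m\<^sub>i\<^sub>+\<^sub>k\<^sub>-\<^sub>1\<close> makes the left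
  sides telescope over a period and turns the right sides into \<open>c\<close> times the terms of \<open>P_poly\<close>. The
  statement covers the case of equal products too, where it forces \<open>c P = 0\<close>.
\<close>

lemma P_poly_telescope:
  assumes l: "periodic n l" and m: "periodic n m" and Q: "periodic n Q"
    and rec: "\<And>j. m j * Q j - l j * Q (j - 1) = c * (l j * m j)"
  shows "((\<Prod>j = 1..int n + 1. m j) - (\<Prod>j = 1..int n + 1. l j)) * Q i = c * P_poly n l m i"
proof -
  define N where "N = int n + 1"
  define t where "t k = (\<Prod>j = k + 1..N. l (i + j)) * (\<Prod>j = 1..k. m (i + j)) * Q (i + k)" for k
  have tk: "t k - t (k - 1) = c * ((\<Prod>j = k..N. l (i + j)) * (\<Prod>j = 1..k. m (i + j)))"
    if "k \<in> {1..N}" for k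
  proof -
    have 1: "(\<Prod>j = k..N. l (i + j)) = l (i + k) * (\<Prod>j = k + 1..N. l (i + j))"
      and 2: "(\<Prod>j = 1..k. m (i + j)) = m (i + k) * (\<Prod>j = 1..k - 1. m (i + j))"
      using that by (simp_all add: prod_int_head[of k] prod_int_last[of _ k])
    have "t k - t (k - 1) = (\<Prod>j = k + 1..N. l (i + j)) * (\<Prod>j = 1..k - 1. m (i + j)) *
        (m (i + k) * Q (i + k) - l (i + k) * Q (i + k - 1))"
      unfolding t_def using 1 2 by (simp add: algebra_simps)
    then show ?thesis unfolding rec 1 2 by (simp add: algebra_simps)
  qed
  have "c * P_poly n l m i = (\<Sum>k = 1..N. t k - t (k - 1))"
    unfolding P_poly_def N_def[symmetric] sum_distrib_left
    by (rule sum.cong[OF refl], rule tk[symmetric])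
  also have "\<dots> = t N - t 0" using sum_telescope_int[of t "n + 1"] by (simp add: N_def add.commute)
  also have "t N = (\<Prod>j = 1..N. m j) * Q i"
    using prod_period_shift[OF m, of i] periodicD[OF Q, of i] by (simp add: t_def N_def)
  also have "t 0 = (\<Prod>j = 1..N. l j) * Q i"
    using prod_period_shift[OF l, of i] by (simp add: t_def N_def)
  finally show ?thesis by (simp add: N_def algebra_simps)
qed

text \<open>
  The \<open>k\<close>-th term of \<open>m\<^sub>i P\<^sub>i\<close> is the \<open>(k + 1)\<close>-st term of \<open>l\<^sub>i P\<^sub>i\<^sub>-\<^sub>1\<close>, so only the two boundary
  terms survive in the difference.
\<close>

lemma P_poly_recurrence:
  assumes l: "periodic n l" and m: "periodic n m"
  shows "m i * P_poly n l m i - l i * P_poly n l m (i - 1) =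
    ((\<Prod>j = 1..int n + 1. m j) - (\<Prod>j = 1..int n + 1. l j)) * (l i * m i)"
proof -
  define N where "N = int n + 1"
  define t where "t k = (\<Prod>j = k - 1..N. l (i + j)) * (\<Prod>j = 0..k - 1. m (i + j))" for k
  have "m i * P_poly n l m i = (\<Sum>k = 1..N. t (k + 1))"
    unfolding P_poly_def N_def[symmetric] sum_distrib_left
  proof (rule sum.cong[OF refl])
    fix k assume "k \<in> {1..N}"
    then have "(\<Prod>j = 0..k. m (i + j)) = m i * (\<Prod>j = 1..k. m (i + j))"
      using prod_int_head[of 0 k] by simp
    then show "m i * ((\<Prod>j = k..N. l (i + j)) * (\<Prod>j = 1..k. m (i + j))) = t (k + 1)"
      by (simp add: t_def)
  qed
  moreover have "l i * P_poly n l m (i - 1) = (\<Sum>k = 1..N. t k)"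
    unfolding P_poly_def N_def[symmetric] sum_distrib_left
  proof (rule sum.cong[OF refl])
    fix k assume k: "k \<in> {1..N}"
    have "(\<Prod>j = k..N. l (i - 1 + j)) = (\<Prod>j = k - 1..N - 1. l (i + j))"
      and "(\<Prod>j = 1..k. m (i - 1 + j)) = (\<Prod>j = 0..k - 1. m (i + j))"
      unfolding prod_int_shift by (simp_all add: algebra_simps)
    moreover have "(\<Prod>j = k - 1..N. l (i + j)) = l i * (\<Prod>j = k - 1..N - 1. l (i + j))"
      using prod_int_last[of "k - 1" N "\<lambda>j. l (i + j)"] periodicD[OF l, of i] k by (simp add: N_def)
    ultimately show "l i * ((\<Prod>j = k..N. l (i - 1 + j)) * (\<Prod>j = 1..k. m (i - 1 + j))) = t k"
      by (simp add: t_def)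
  qed
  ultimately have "m i * P_poly n l m i - l i * P_poly n l m (i - 1) =
      (\<Sum>k = 1..N. t (k + 1) - t k)" by (simp add: sum_subtractf)
  also have "\<dots> = t (N + 1) - t 1"
    using sum_telescope_int[of "\<lambda>k. t (k + 1)" "n + 1"] by (simp add: N_def add.commute)
  also have "t (N + 1) = l i * (m i * (\<Prod>j = 1..N. m j))"
    using prod_period_shift[OF m, of i] periodicD[OF l, of i] prod_int_head[of 0 N "\<lambda>j. m (i + j)"]
    by (simp add: t_def N_def[symmetric]) (simp add: N_def)
  also have "t 1 = l i * (\<Prod>j = 1..N. l j) * m i"
    using prod_period_shift[OF l, of i] prod_int_head[of 0 N "\<lambda>j. l (i + j)"] by (simp add: t_def N_def)
  finally show ?thesis by (simp add: N_def algebra_simps)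
qed

section \<open>Characterisation of the explicit map at a point\<close>

lemma B_points_iff:
  "l \<in> B_points n L \<longleftrightarrow> periodic n l \<and> (\<forall>i. l i \<noteq> 0) \<and> (\<Prod>j = 1..int n + 1. l j) = of_real L"
  by (simp add: B_points_def periodic_def)

definition P_nonzero :: "nat \<Rightarrow> (int \<Rightarrow> complex) \<times> (int \<Rightarrow> complex) \<Rightarrow> bool" where
  "P_nonzero n x \<longleftrightarrow> (\<forall>i. P_poly n (fst x) (snd x) i \<noteq> 0)"

lemma R_explicit_in_points:
  assumes l: "l \<in> B_points n L" and m: "m \<in> B_points n M" and P: "P_nonzero n (l, m)"
  shows "R_explicit n (l, m) \<in> B_points n M \<times> B_points n L"
proof -
  have pl: "periodic n l" and pm: "periodic n m" using l m by (auto simp: B_points_iff)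
  define p where "p = P_poly n l m"
  have pp: "periodic n p" unfolding p_def using pl pm by (rule P_poly_periodic)
  have pp1: "p (i + (int n + 1) - 1) = p (i - 1)" for i
    using periodicD[OF pp, of "i - 1"] by (simp add: algebra_simps)
  have nz: "p i \<noteq> 0" for i using P by (simp add: P_nonzero_def p_def)
  have "(\<Prod>j = 1..int n + 1. p (j - 1)) = (\<Prod>j = 1..int n + 1. p j)"
    using prod_period_shift[OF pp, of "-1"] by simp
  then show ?thesis
    using l m nz pp1 periodicD[OF pp] periodicD[OF pl] periodicD[OF pm]
    by (simp add: R_explicit_def p_def[symmetric] B_points_iff periodic_def prod.distrib prod_dividef)
qed

text \<open>
  By the recurrence, \<open>1 / l'\<^sub>i = 1 / l\<^sub>i - (M - L) / P\<^sub>i\<close> and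
  \<open>1 / m'\<^sub>i\<^sub>+\<^sub>1 = 1 / m\<^sub>i\<^sub>+\<^sub>1 + (M - L) / P\<^sub>i\<close>, and the corrections cancel.
\<close>

lemma R_explicit_invariants:
  assumes l: "l \<in> B_points n L" and m: "m \<in> B_points n M" and P: "P_nonzero n (l, m)"
    and R: "R_explicit n (l, m) = (l', m')"
  shows "l' i * m' i = l i * m i"
    and "1 / l' i + 1 / m' (i + 1) = 1 / l i + 1 / m (i + 1)"
proof -
  define p where "p = P_poly n l m"
  have nz: "p i \<noteq> 0" "l i \<noteq> 0" "m i \<noteq> 0" for i
    using P l m by (auto simp: P_nonzero_def p_def B_points_iff)
  have l': "l' = (\<lambda>i. m i * (p i / p (i - 1)))" and m': "m' = (\<lambda>i. l i * (p (i - 1) / p i))"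
    using R by (auto simp: R_explicit_def p_def)
  show "l' i * m' i = l i * m i" using nz by (simp add: l' m')
  have rec: "m i * p i - l i * p (i - 1) = (of_real M - of_real L) * (l i * m i)" for i
    unfolding p_def using P_poly_recurrence[of n l m i] l m by (simp add: B_points_iff)
  have "1 / l' i = p (i - 1) / m i / p i" by (simp add: l')
  also have "p (i - 1) / m i = p i / l i - (of_real M - of_real L)"
    using rec[of i] nz by (simp add: field_simps)
  finally have 1: "1 / l' i = 1 / l i - (of_real M - of_real L) / p i"
    using nz by (simp add: diff_divide_distrib)
  have "1 / m' (i + 1) = p (i + 1) / l (i + 1) / p i" by (simp add: m')
  also have "p (i + 1) / l (i + 1) = p i / m (i + 1) + (of_real M - of_real L)"
    using rec[of "i + 1"] nz by (simp add: field_simps)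
  finally have 2: "1 / m' (i + 1) = 1 / m (i + 1) + (of_real M - of_real L) / p i"
    using nz by (simp add: add_divide_distrib)
  show "1 / l' i + 1 / m' (i + 1) = 1 / l i + 1 / m (i + 1)" by (simp add: 1 2)
qed

lemma R_explicit_same_product:
  assumes l: "l \<in> B_points n L" and m: "m \<in> B_points n L" and P: "P_nonzero n (l, m)"
  shows "R_explicit n (l, m) = (l, m)"
proof -
  have "m i * P_poly n l m i = l i * P_poly n l m (i - 1)" for i
    using P_poly_recurrence[of n l m i] l m by (simp add: B_points_iff)
  then show ?thesis using P
    by (auto simp: R_explicit_def P_nonzero_def fun_eq_iff field_simps)
qed

text \<open>
  The old \<open>P\<close> solves the recurrence of the new pair \<open>(l', m')\<close> with constant \<open>L - M\<close>, because
  \<open>m'\<^sub>i P\<^sub>i = l\<^sub>i P\<^sub>i\<^sub>-\<^sub>1\<close> and \<open>l'\<^sub>i P\<^sub>i\<^sub>-\<^sub>1 = m\<^sub>i P\<^sub>i\<close>. Telescoping identifies it with the new one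
  when \<open>L \<noteq> M\<close>; otherwise the pair is fixed.
\<close>

lemma P_poly_R_explicit:
  assumes l: "l \<in> B_points n L" and m: "m \<in> B_points n M" and P: "P_nonzero n (l, m)"
    and R: "R_explicit n (l, m) = (l', m')"
  shows "P_poly n l' m' = P_poly n l m"
proof (cases "L = M")
  case True
  then show ?thesis using R_explicit_same_product[of l n L m] l m P R by simp
next
  case False
  define p where "p = P_poly n l m"
  have nz: "p i \<noteq> 0" "l i \<noteq> 0" "m i \<noteq> 0" for i
    using P l m by (auto simp: P_nonzero_def p_def B_points_iff)
  have l': "l' = (\<lambda>i. m i * (p i / p (i - 1)))" and m': "m' = (\<lambda>i. l i * (p (i - 1) / p i))"
    using R by (auto simp: R_explicit_def p_def)
  have pts: "l' \<in> B_points n M" "m' \<in> B_points n L"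
    using R_explicit_in_points[OF l m P] R by auto
  have rec: "m i * p i - l i * p (i - 1) = (of_real M - of_real L) * (l i * m i)" for i
    unfolding p_def using P_poly_recurrence[of n l m i] l m by (simp add: B_points_iff)
  have "m' j * p j - l' j * p (j - 1) = (of_real L - of_real M) * (l' j * m' j)" for j
    using rec[of j] nz[of j] nz[of "j - 1"] by (simp add: l' m') (simp add: algebra_simps)
  moreover have "periodic n p" unfolding p_def using l m by (auto simp: B_points_iff intro: P_poly_periodic)
  ultimately have "(of_real L - of_real M) * p i = (of_real L - of_real M) * P_poly n l' m' i" for i
    using P_poly_telescope[of n l' m' p "of_real L - of_real M" i] pts unfolding B_points_iff by simp
  then show ?thesis using False by (auto simp: p_def)
qed

lemma R_explicit_involution:
  assumes l: "l \<in> B_points n L" and m: "m \<in> B_points n M" and P: "P_nonzero n (l, m)"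
  shows "P_nonzero n (R_explicit n (l, m))" and "R_explicit n (R_explicit n (l, m)) = (l, m)"
proof -
  obtain l' m' where R: "R_explicit n (l, m) = (l', m')" by fastforce
  note P' = P_poly_R_explicit[OF l m P R]
  show "P_nonzero n (R_explicit n (l, m))" using P P' R by (simp add: P_nonzero_def)
  show "R_explicit n (R_explicit n (l, m)) = (l, m)"
  proof -
    have l': "l' = (\<lambda>i. m i * (P_poly n l m i / P_poly n l m (i - 1)))"
      and m': "m' = (\<lambda>i. l i * (P_poly n l m (i - 1) / P_poly n l m i))"
      using R by (auto simp: R_explicit_def)
    have "R_explicit n (l', m') = (\<lambda>i. m' i * (P_poly n l m i / P_poly n l m (i - 1)),
        \<lambda>i. l' i * (P_poly n l m (i - 1) / P_poly n l m i))"
      by (simp add: R_explicit_def P')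
    then show ?thesis using P by (simp add: R l' m' P_nonzero_def)
  qed
qed

text \<open>
  Eliminating \<open>m'\<close> gives
  \<open>l'\<^sub>i\<^sub>+\<^sub>1 - l\<^sub>i\<^sub>+\<^sub>1 = l\<^sub>i\<^sub>+\<^sub>1 m\<^sub>i\<^sub>+\<^sub>1 (l'\<^sub>i - l\<^sub>i) / (l\<^sub>i l'\<^sub>i)\<close>, a Moebius recursion that becomes affine
  for the reciprocals of \<open>l'\<^sub>i - l\<^sub>i\<close>. Rescaled, these reciprocals solve the recurrence that
  \<open>P_poly_telescope\<close> integrates over a period. The exceptional solution \<open>l' = l\<close> needs \<open>L = M\<close> and
  is then the explicit one.
\<close>

lemma R_explicit_unique:
  assumes l: "l \<in> B_points n L" and m: "m \<in> B_points n M" and P: "P_nonzero n (l, m)"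
    and l': "l' \<in> B_points n M" and m': "m' \<in> B_points n L"
    and b: "\<And>i. l' i * m' i = l i * m i"
    and s: "\<And>i. 1 / l' i + 1 / m' (i + 1) = 1 / l i + 1 / m (i + 1)"
  shows "(l', m') = R_explicit n (l, m)"
proof -
  define p where "p = P_poly n l m"
  have nz: "p i \<noteq> 0" "l i \<noteq> 0" "m i \<noteq> 0" "l' i \<noteq> 0" "m' i \<noteq> 0" for i
    using P l m l' m' by (auto simp: P_nonzero_def p_def B_points_iff)
  have step: "l' (i + 1) - l (i + 1) = m (i + 1) * l (i + 1) * ((l' i - l i) / (l i * l' i))" for i
  proof -
    have "m' (i + 1) = l (i + 1) * m (i + 1) / l' (i + 1)"
      using b[of "i + 1"] nz by (simp add: field_simps)
    then have "1 / m' (i + 1) = l' (i + 1) / (l (i + 1) * m (i + 1))" by simp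
    then have "l' (i + 1) / (l (i + 1) * m (i + 1)) = 1 / l i + 1 / m (i + 1) - 1 / l' i"
      using s[of i] by (simp add: eq_diff_eq add.commute)
    moreover have "l' (i + 1) = l' (i + 1) / (l (i + 1) * m (i + 1)) * (l (i + 1) * m (i + 1))"
      using nz(2,3)[of "i + 1"] by simp
    ultimately have "l' (i + 1) = (1 / l i + 1 / m (i + 1) - 1 / l' i) * (l (i + 1) * m (i + 1))"
      by metis
    also have "\<dots> = l (i + 1) + m (i + 1) * l (i + 1) * ((l' i - l i) / (l i * l' i))"
      using nz by (simp add: field_simps)
    finally show ?thesis by simp
  qed
  have iff: "l' (i + 1) = l (i + 1) \<longleftrightarrow> l' i = l i" for i
    using step[of i] nz[of i] nz[of "i + 1"] by auto
  have all_iff: "l' i = l i \<longleftrightarrow> l' 0 = l 0" for i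
  proof (induction i rule: int_induct[of _ 0])
    case (step2 i)
    then show ?case using iff[of "i - 1"] by simp
  qed (use iff in auto)
  have l'_eq: "l' i = m i * (p i / p (i - 1))" for i
  proof (cases "l' 0 = l 0")
    case True
    then have "l' = l" using all_iff by blast
    then have "(of_real M :: complex) = of_real L" using l l' by (simp add: B_points_iff)
    then have "M = L" by simp
    then have "m i * p i = l i * p (i - 1)"
      unfolding p_def using P_poly_recurrence[of n l m i] l m by (simp add: B_points_iff)
    then show ?thesis using nz[of i] nz[of "i - 1"] \<open>l' = l\<close> by (simp add: field_simps)
  next
    case False
    then have d: "l' i - l i \<noteq> 0" for i using all_iff[of i] by auto
    define Q where "Q i = l (i + 1) * m (i + 1) / (l' (i + 1) - l (i + 1))" for i
    have shift: "a (i + (int n + 1) + 1) = a (i + 1)" if "a \<in> B_points n K" for a K i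
      using that periodicD[of n a "i + 1"] by (simp add: B_points_iff algebra_simps)
    have Q: "periodic n Q" by (simp only: periodic_def Q_def shift[OF l] shift[OF m] shift[OF l']) simp
    have Q': "Q i = l i * l' i / (l' i - l i)" for i
      unfolding Q_def step using nz d[of i] by (simp add: field_simps)
    have rec: "m j * Q j - l j * Q (j - 1) = 1 * (l j * m j)" for j
      using d[of j] unfolding Q'[of j] by (simp add: Q_def divide_simps) (simp add: algebra_simps)
    \<comment> \<open>Since \<open>p\<close> does not vanish, this excludes \<open>L = M\<close> and determines \<open>Q\<close>.\<close>
    have "(of_real M - of_real L) * Q i = p i" for i
      using P_poly_telescope[OF _ _ Q rec, of i] l m by (simp add: p_def B_points_iff)
    then have "p i = (of_real M - of_real L) * Q i" for i by simp
    moreover have "of_real M - of_real L \<noteq> (0 :: complex)"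
      using nz(1)[of 0] calculation[of 0] by auto
    ultimately have "p i / p (i - 1) = Q i / Q (i - 1)" by simp
    also have "\<dots> = l' i / m i"
      using nz(2,3)[of i] d[of i] unfolding Q'[of i] by (simp add: Q_def)
    finally show ?thesis using nz(3)[of i] by simp
  qed
  moreover have "m' i = l i * (p (i - 1) / p i)" for i
  proof -
    have "m' i = l i * m i / l' i" using b[of i] nz[of i] by (simp add: field_simps)
    then show ?thesis using nz by (simp add: l'_eq)
  qed
  ultimately show ?thesis by (auto simp: R_explicit_def p_def)
qed

section \<open>Yang-Baxter equation from factorisations of difference operators\<close>

text \<open>
  The first-order difference operator \<open>1 / l + T\<close> with \<open>T\<close> the shift, acting on all sequences (not
  only on periodic ones).
\<close>

definition lax :: "(int \<Rightarrow> complex) \<Rightarrow> (int \<Rightarrow> complex) \<Rightarrow> (int \<Rightarrow> complex)" where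
  "lax l f = (\<lambda>i. f i / l i + f (i + 1))"

definition multiplier :: "nat \<Rightarrow> complex \<Rightarrow> (int \<Rightarrow> complex) \<Rightarrow> bool" where
  "multiplier n \<mu> f \<longleftrightarrow> (\<forall>i. f (i + (int n + 1)) = \<mu> * f i)"

text \<open>
  The coefficients of the composite operator are \<open>1 / (l\<^sub>i m\<^sub>i)\<close>, \<open>1 / l\<^sub>i + 1 / m\<^sub>i\<^sub>+\<^sub>1\<close> and \<open>1\<close>,
  that is, the invariants.
\<close>

lemma lax_R_explicit:
  assumes l: "l \<in> B_points n L" and m: "m \<in> B_points n M" and P: "P_nonzero n (l, m)"
    and R: "R_explicit n (l, m) = (l', m')"
  shows "lax l' (lax m' f) = lax l (lax m f)"
proof
  fix i
  have b: "1 / (l' i * m' i) = 1 / (l i * m i)"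
    using R_explicit_invariants(1)[OF assms, of i] by simp
  have "lax a (lax c f) i = 1 / (a i * c i) * f i + (1 / a i + 1 / c (i + 1)) * f (i + 1) + f (i + 2)"
    for a c by (simp add: lax_def add_divide_distrib algebra_simps)
  then show "lax l' (lax m' f) i = lax l (lax m f) i"
    using R_explicit_invariants(2)[OF assms, of i] b by simp
qed

lemma multiplier_lax: "periodic n l \<Longrightarrow> multiplier n \<mu> f \<Longrightarrow> multiplier n \<mu> (lax l f)"
  unfolding multiplier_def lax_def
proof
  fix i assume l: "periodic n l" and f: "\<forall>i. f (i + (int n + 1)) = \<mu> * f i"
  have "f (i + (int n + 1) + 1) = \<mu> * f (i + 1)" using f[rule_format, of "i + 1"] by (simp add: algebra_simps)
  then show "f (i + (int n + 1)) / l (i + (int n + 1)) + f (i + (int n + 1) + 1) = \<mu> * (f i / l i + f (i + 1))"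
    unfolding periodicD[OF l] f[rule_format, of i] by (simp add: algebra_simps)
qed

text \<open>
  The multiplier is the product of the ratios \<open>- 1 / l\<^sub>i\<close> of consecutive values over a period.
\<close>

lemma kernel_lax_multiplier:
  assumes l: "l \<in> B_points n L" and f: "\<And>i. lax l f i = 0"
  shows "multiplier n ((-1) ^ (n + 1) / of_real L) f"
proof -
  have step: "f (i + 1) = - f i / l i" for i
    using f[of i] by (simp add: lax_def) (metis add.commute add_eq_0_iff)
  have it: "f (i + int k) = (-1) ^ k * f i / (\<Prod>j = i..i + int k - 1. l j)" for i k
  proof (induction k)
    case (Suc k)
    have "{i..i + int (Suc k) - 1} = insert (i + int k) {i..i + int k - 1}" by auto
    then have "(\<Prod>j = i..i + int (Suc k) - 1. l j) = l (i + int k) * (\<Prod>j = i..i + int k - 1. l j)"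
      by simp
    moreover have "f (i + int (Suc k)) = - f (i + int k) / l (i + int k)"
      using step[of "i + int k"] by (simp add: algebra_simps)
    ultimately show ?case using Suc by simp
  qed simp
  have "(\<Prod>j = i..i + int (n + 1) - 1. l j) = of_real L" for i
    using prod_period_shift[of n l "i - 1"] l unfolding prod_int_shift B_points_iff
    by (simp add: algebra_simps)
  then show ?thesis unfolding multiplier_def using it[of _ "n + 1"] by (simp add: add.commute)
qed

lemma lax_injective_multiplier:
  assumes l: "l \<in> B_points n L" and f: "multiplier n ((-1) ^ (n + 1) / of_real M) f"
    and "L \<noteq> M" "L \<noteq> 0" "M \<noteq> 0" "\<And>i. lax l f i = 0"
  shows "f i = 0"
proof -
  have "(-1) ^ (n + 1) / of_real M * f i = (-1) ^ (n + 1) / of_real L * f i"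
    using f kernel_lax_multiplier[OF l assms(6)] unfolding multiplier_def by metis
  then show ?thesis using assms(3-5) by (auto simp: field_simps)
qed

lemma lax_kernel_exists:
  assumes "\<And>i. l i \<noteq> 0"
  obtains f where "\<And>i. lax l f i = 0" "\<And>i. f i \<noteq> 0"
proof
  define f where "f i = (if i \<ge> 0 then \<Prod>j = 0..i - 1. - 1 / l j else 1 / (\<Prod>j = i..-1. - 1 / l j))" for i
  show "f i \<noteq> 0" for i using assms by (auto simp: f_def)
  show "lax l f i = 0" for i
  proof -
    consider "i \<ge> 0" | "i = -1" | "i < -1" by linarith
    then show ?thesis
    proof cases
      case 1
      then show ?thesis using prod_int_last[of 0 i "\<lambda>j. - 1 / l j"] by (simp add: lax_def f_def)
    next
      case 2
      then show ?thesis using assms by (simp add: lax_def f_def)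
    next
      case 3
      then show ?thesis using prod_int_head[of i "-1" "\<lambda>j. - 1 / l j"] assms
        by (simp add: lax_def f_def)
    qed
  qed
qed

lemma lax_kernel_determines:
  assumes "\<And>i. f i \<noteq> 0" "\<And>i. lax l f i = 0" "\<And>i. lax m f i = 0"
    "\<And>i. l i \<noteq> 0" "\<And>i. m i \<noteq> 0"
  shows "l = m"
proof
  fix i
  have "f i / l i = f i / m i" using assms(2)[of i] assms(3)[of i] unfolding lax_def
    by (metis add_right_cancel)
  then show "l i = m i" using assms(1,4,5)[of i] by (simp add: field_simps)
qed

text \<open>
  Take \<open>f\<close> in the kernel of the rightmost factor of one factorisation. The other factorisation
  annihilates it as well, but its two left factors are injective on sequences with the multiplier of
  \<open>f\<close>, so \<open>f\<close> is killed by the other rightmost factor, which it determines. Then the products of the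
  two left factors agree, and the same argument applies again.
\<close>

lemma lax_triple_unique:
  assumes pts: "l1 \<in> B_points n L" "m1 \<in> B_points n M" "k1 \<in> B_points n K"
      "l2 \<in> B_points n L" "m2 \<in> B_points n M" "k2 \<in> B_points n K"
    and ne: "L \<noteq> M" "L \<noteq> K" "M \<noteq> K" "L \<noteq> 0" "M \<noteq> 0" "K \<noteq> 0"
    and eq: "\<And>f. lax l1 (lax m1 (lax k1 f)) = lax l2 (lax m2 (lax k2 f))"
  shows "l1 = l2 \<and> m1 = m2 \<and> k1 = k2"
proof -
  have nz: "l1 i \<noteq> 0" "m1 i \<noteq> 0" "k1 i \<noteq> 0" "l2 i \<noteq> 0" "m2 i \<noteq> 0" "k2 i \<noteq> 0" for i
    using pts by (auto simp: B_points_iff)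
  have per: "periodic n l1" "periodic n m1" "periodic n k1" using pts by (auto simp: B_points_iff)
  have lax0: "lax a (\<lambda>_. 0) = (\<lambda>_. 0)" for a by (simp add: lax_def)
  obtain f where f: "\<And>i. lax k2 f i = 0" "\<And>i. f i \<noteq> 0" using lax_kernel_exists[of k2] nz by blast
  have mf: "multiplier n ((-1) ^ (n + 1) / of_real K) f" by (rule kernel_lax_multiplier[OF pts(6) f(1)])
  have "lax k2 f = (\<lambda>_. 0)" using f by auto
  then have z: "lax l1 (lax m1 (lax k1 f)) i = 0" for i unfolding eq by (simp add: lax0)
  have mk: "lax m1 (lax k1 f) i = 0" for i
    using lax_injective_multiplier[OF pts(1) multiplier_lax[OF per(2) multiplier_lax[OF per(3) mf]]
      ne(2,4,6) z] .
  have "lax k1 f i = 0" for i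
    using lax_injective_multiplier[OF pts(2) multiplier_lax[OF per(3) mf] ne(3,5,6) mk] .
  then have k: "k1 = k2" by (intro lax_kernel_determines[OF f(2) _ f(1)] nz)
  have expand: "lax l (lax m (lax k f)) i = f i / (l i * m i * k i)
      + (1 / (l i * m i) + (1 / l i + 1 / m (i + 1)) / k (i + 1)) * f (i + 1)
      + (1 / l i + 1 / m (i + 1) + 1 / k (i + 2)) * f (i + 2) + f (i + 3)" for l m k f i
    by (simp add: lax_def add_divide_distrib algebra_simps)
  \<comment> \<open>Cancelling the common right factor: delta sequences at \<open>i\<close> and \<open>i + 2\<close> read off coefficients.\<close>
  have b: "1 / (l1 i * m1 i) = 1 / (l2 i * m2 i)" for i
    using fun_cong[OF eq[of "\<lambda>j. if j = i then 1 else 0"], of i] nz unfolding expand k by simp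
  have s: "1 / l1 i + 1 / m1 (i + 1) = 1 / l2 i + 1 / m2 (i + 1)" for i
    using fun_cong[OF eq[of "\<lambda>j. if j = i + 2 then 1 else 0"], of i] unfolding expand k by simp
  have pair: "lax l (lax m f) i = 1 / (l i * m i) * f i + (1 / l i + 1 / m (i + 1)) * f (i + 1) + f (i + 2)"
    for l m f i by (simp add: lax_def add_divide_distrib algebra_simps)
  have eq2: "lax l1 (lax m1 f) = lax l2 (lax m2 f)" for f
    by (rule ext) (simp only: pair b s)
  obtain g where g: "\<And>i. lax m2 g i = 0" "\<And>i. g i \<noteq> 0" using lax_kernel_exists[of m2] nz by blast
  have mg: "multiplier n ((-1) ^ (n + 1) / of_real M) g" by (rule kernel_lax_multiplier[OF pts(5) g(1)])
  have "lax m2 g = (\<lambda>_. 0)" using g by auto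
  then have z: "lax l1 (lax m1 g) i = 0" for i unfolding eq2 by (simp add: lax0)
  have "lax m1 g i = 0" for i
    using lax_injective_multiplier[OF pts(1) multiplier_lax[OF per(2) mg] ne(1,4,5) z] .
  then have m: "m1 = m2" by (intro lax_kernel_determines[OF g(2) _ g(1)] nz)
  have "l1 = l2" using b nz unfolding m by (auto simp: fun_eq_iff field_simps)
  with m k show ?thesis by blast
qed

text \<open>
  For distinct products the two triples come from factorisations of one operator. If the first two
  or the last two products agree, one map on each side is the identity and the remaining ones match up; if
  the outer two agree, the middle map is the identity and the outer ones cancel by involutivity.
\<close>

lemma yang_baxter_pointwise:
  assumes l: "l \<in> B_points n L" and m: "m \<in> B_points n M" and k: "k \<in> B_points n K"
    and nz: "L \<noteq> 0" "M \<noteq> 0" "K \<noteq> 0"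
    and a: "P_nonzero n (l, m)" "R_explicit n (l, m) = (m1, l1)"
      "P_nonzero n (l1, k)" "R_explicit n (l1, k) = (k1, l2)"
      "P_nonzero n (m1, k1)" "R_explicit n (m1, k1) = (k2, m2)"
    and c: "P_nonzero n (m, k)" "R_explicit n (m, k) = (k3, m3)"
      "P_nonzero n (l, k3)" "R_explicit n (l, k3) = (k4, l3)"
      "P_nonzero n (l3, m3)" "R_explicit n (l3, m3) = (m4, l4)"
  shows "(k2, m2, l2) = (k4, m4, l4)"
proof -
  note p1 = R_explicit_in_points[OF l m a(1), unfolded a(2)]
  have l1: "l1 \<in> B_points n L" and m1: "m1 \<in> B_points n M" using p1 by auto
  note p2 = R_explicit_in_points[OF l1 k a(3), unfolded a(4)]
  have l2: "l2 \<in> B_points n L" and k1: "k1 \<in> B_points n K" using p2 by auto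
  note p3 = R_explicit_in_points[OF m1 k1 a(5), unfolded a(6)]
  have m2: "m2 \<in> B_points n M" and k2: "k2 \<in> B_points n K" using p3 by auto
  note p4 = R_explicit_in_points[OF m k c(1), unfolded c(2)]
  have m3: "m3 \<in> B_points n M" and k3: "k3 \<in> B_points n K" using p4 by auto
  note p5 = R_explicit_in_points[OF l k3 c(3), unfolded c(4)]
  have l3: "l3 \<in> B_points n L" and k4: "k4 \<in> B_points n K" using p5 by auto
  note p6 = R_explicit_in_points[OF l3 m3 c(5), unfolded c(6)]
  have l4: "l4 \<in> B_points n L" and m4: "m4 \<in> B_points n M" using p6 by auto
  consider "L = M" | "L = K" | "M = K" | "L \<noteq> M" "L \<noteq> K" "M \<noteq> K" by blast
  then show ?thesis
  proof cases
    case 1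
    then have "m1 = l" "l1 = m" "m4 = l3" "l4 = m3"
      using R_explicit_same_product[of _ n L, OF l _ a(1)] m
        R_explicit_same_product[of _ n L, OF l3 _ c(5)] m3 a(2) c(6) by auto
    then show ?thesis using a c by auto
  next
    case 2
    then have "k1 = l1" "l2 = k" "k4 = l" "l3 = k3"
      using R_explicit_same_product[of _ n L, OF l1 _ a(3)] k
        R_explicit_same_product[of _ n L, OF l _ c(3)] k3 a(4) c(4) by auto
    moreover have "(k2, m2) = (l, m)"
      using R_explicit_involution(2)[OF l m a(1)] a calculation by simp
    moreover have "(m4, l4) = (m, k)"
      using R_explicit_involution(2)[OF m k c(1)] c calculation by simp
    ultimately show ?thesis by simp
  next
    case 3
    then have "k2 = m1" "m2 = k1" "k3 = m" "m3 = k"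
      using R_explicit_same_product[of _ n M, OF m1 _ a(5)] k1
        R_explicit_same_product[of _ n M, OF m _ c(1)] k a(6) c(2) by auto
    then show ?thesis using a c by auto
  next
    case 4
    have "lax k2 (lax m2 (lax l2 f)) = lax l (lax m (lax k f))" for f
      using lax_R_explicit[OF l m a(1,2)] lax_R_explicit[OF l1 k a(3,4)] lax_R_explicit[OF m1 k1 a(5,6)]
      by simp
    moreover have "lax k4 (lax m4 (lax l4 f)) = lax l (lax m (lax k f))" for f
      using lax_R_explicit[OF m k c(1,2)] lax_R_explicit[OF l k3 c(3,4)] lax_R_explicit[OF l3 m3 c(5,6)]
      by simp
    ultimately show ?thesis
      using lax_triple_unique[OF k2 m2 l2 k4 m4 l4] 4 nz by metis
  qed
qed

section \<open>Varieties of periodic sequences\<close>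

lemma points_B: "points (B n L) = B_points n L" by (simp add: B_def)

lemma points_prod: "points (X \<otimes> Y) = points X \<times> points Y" by (simp add: crystal_prod_def)

lemma coords_B: "coords (B n L) = {\<lambda>l. l i | i. True}" by (simp add: B_def)

lemma coords_prod:
  "coords (X \<otimes> Y) = {f \<circ> fst | f. f \<in> coords X} \<union> {g \<circ> snd | g. g \<in> coords Y}"
  by (simp add: crystal_prod_def)

lemma coords_BB:
  "coords (B n L \<otimes> B n M) = {\<lambda>x. fst x i | i. True} \<union> {\<lambda>x. snd x i | i. True}"
  unfolding coords_prod coords_B by (auto simp: o_def)

lemma curve_connected_prod:
  assumes "curve_connected X" "curve_connected Y"
  shows "curve_connected (X \<otimes> Y)"
  unfolding curve_connected_def
proof (intro ballI)
  fix p q assume "p \<in> points (X \<otimes> Y)" "q \<in> points (X \<otimes> Y)"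
  then have pq: "fst p \<in> points X" "snd p \<in> points Y" "fst q \<in> points X" "snd q \<in> points Y"
    by (auto simp: points_prod)
  obtain \<gamma> where g: "\<gamma> 0 = fst p" "\<gamma> 1 = fst q" "\<forall>t. \<gamma> t \<in> points X"
    "\<forall>\<phi>\<in>coords X. (\<lambda>t::complex. \<phi> (\<gamma> t)) holomorphic_on UNIV"
    using assms(1) pq unfolding curve_connected_def by blast
  obtain \<delta> where d: "\<delta> 0 = snd p" "\<delta> 1 = snd q" "\<forall>t. \<delta> t \<in> points Y"
    "\<forall>\<phi>\<in>coords Y. (\<lambda>t::complex. \<phi> (\<delta> t)) holomorphic_on UNIV"
    using assms(2) pq unfolding curve_connected_def by blast
  show "\<exists>\<gamma>. \<gamma> 0 = p \<and> \<gamma> 1 = q \<and> (\<forall>t. \<gamma> t \<in> points (X \<otimes> Y)) \<and>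
     (\<forall>\<phi>\<in>coords (X \<otimes> Y). (\<lambda>t::complex. \<phi> (\<gamma> t)) holomorphic_on UNIV)"
    by (rule exI[of _ "\<lambda>t. (\<gamma> t, \<delta> t)"]) (use g d in \<open>auto simp: points_prod coords_prod\<close>)
qed

text \<open>
  The curve is \<open>x\<^sub>j (y\<^sub>j / x\<^sub>j)\<^sup>t\<close>, with logarithms chosen such that they sum to zero over a period, which keeps
  the product constant.
\<close>

lemma curve_connected_B: "curve_connected (B n L)"
  unfolding curve_connected_def
proof (intro ballI)
  fix x y assume "x \<in> points (B n L)" "y \<in> points (B n L)"
  then have x: "x \<in> B_points n L" and y: "y \<in> B_points n L" by (auto simp: points_B)
  have nz: "x j \<noteq> 0" "y j \<noteq> 0" for j using x y by (auto simp: B_points_iff)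
  \<comment> \<open>The principal logarithms sum to a multiple of \<open>2 \<pi> \<i>\<close>, which is subtracted from one of them.\<close>
  define s where "s = (\<Sum>j = 1..int n + 1. Ln (y j / x j))"
  define a where "a j = Ln (y j / x j) - (if int n + 1 dvd j then s else 0)" for j
  have "exp s = (\<Prod>j = 1..int n + 1. y j / x j)"
    unfolding s_def using nz by (simp add: exp_sum)
  also have "\<dots> = (\<Prod>j = 1..int n + 1. y j) / (\<Prod>j = 1..int n + 1. x j)" by (rule prod_dividef)
  also have "(\<Prod>j = 1..int n + 1. y j) = (\<Prod>j = 1..int n + 1. x j)"
    using x y by (simp add: B_points_iff)
  also have "\<dots> / (\<Prod>j = 1..int n + 1. x j) = 1" using nz by simp
  finally have s: "exp s = 1" .
  have "(\<Sum>j = 1..int n + 1. if int n + 1 dvd j then s else 0) = (\<Sum>j = 1..int n + 1. if j = int n + 1 then s else 0)"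
    by (rule sum.cong) (auto dest: zdvd_imp_le)
  then have a0: "(\<Sum>j = 1..int n + 1. a j) = 0" by (simp add: a_def sum_subtractf s_def)
  have ea: "exp (a j) = y j / x j" for j using nz s by (auto simp: a_def exp_diff)
  have pa: "a (j + (int n + 1)) = a j" for j
    using x y unfolding a_def B_points_iff by (simp only: periodicD dvd_add_triv_right_iff)
  define \<gamma> where "\<gamma> t j = x j * exp (t * a j)" for t j
  have "\<gamma> t \<in> B_points n L" for t
  proof -
    have "(\<Prod>j = 1..int n + 1. \<gamma> t j) = of_real L * exp (t * (\<Sum>j = 1..int n + 1. a j))"
      using x by (simp add: \<gamma>_def prod.distrib B_points_iff exp_sum[symmetric] sum_distrib_left)
    moreover have "periodic n (\<gamma> t)"
      using x by (simp only: periodic_def \<gamma>_def pa B_points_iff) simp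
    ultimately show ?thesis using nz a0 by (simp add: B_points_iff) (simp add: \<gamma>_def)
  qed
  moreover have "\<gamma> 0 = x" "\<gamma> 1 = y" using nz by (auto simp: \<gamma>_def ea fun_eq_iff)
  moreover have "(\<lambda>t. \<gamma> t j) holomorphic_on UNIV" for j
    unfolding \<gamma>_def by (intro holomorphic_intros)
  ultimately show "\<exists>\<gamma>. \<gamma> 0 = x \<and> \<gamma> 1 = y \<and> (\<forall>t. \<gamma> t \<in> points (B n L)) \<and>
     (\<forall>\<phi>\<in>coords (B n L). (\<lambda>t::complex. \<phi> (\<gamma> t)) holomorphic_on UNIV)"
    by (intro exI[of _ \<gamma>]) (auto simp: points_B coords_B)
qed

lemma curve_connected_BB: "curve_connected (B n L \<otimes> B n M)"
  by (intro curve_connected_prod curve_connected_B)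

lemma reg_at_fst: "reg_at X (fst x0) \<phi> \<Longrightarrow> reg_at (X \<otimes> Y) x0 (\<lambda>x. \<phi> (fst x))"
proof -
  have *: "f \<in> poly_funs X \<Longrightarrow> (\<lambda>x. f (fst x)) \<in> poly_funs (X \<otimes> Y)" for f
  proof (induction rule: poly_funs.induct)
    case (coord f)
    then have "f \<circ> fst \<in> coords (X \<otimes> Y)" by (auto simp: coords_prod)
    from poly_funs.coord[OF this] show ?case by (simp add: o_def)
  qed (auto intro: poly_funs.intros)
  assume "reg_at X (fst x0) \<phi>"
  then obtain f g where fg: "f \<in> poly_funs X" "g \<in> poly_funs X" "g (fst x0) \<noteq> 0"
     "\<forall>x\<in>points X. g x \<noteq> 0 \<longrightarrow> \<phi> x = f x / g x" unfolding reg_at_def by blast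
  show ?thesis unfolding reg_at_def
    by (intro bexI[OF _ *[OF fg(1)]] bexI[OF _ *[OF fg(2)]]) (use fg in \<open>auto simp: points_prod\<close>)
qed

lemma reg_at_snd: "reg_at Y (snd x0) \<phi> \<Longrightarrow> reg_at (X \<otimes> Y) x0 (\<lambda>x. \<phi> (snd x))"
proof -
  have *: "f \<in> poly_funs Y \<Longrightarrow> (\<lambda>x. f (snd x)) \<in> poly_funs (X \<otimes> Y)" for f
  proof (induction rule: poly_funs.induct)
    case (coord f)
    then have "f \<circ> snd \<in> coords (X \<otimes> Y)" by (auto simp: coords_prod)
    from poly_funs.coord[OF this] show ?case by (simp add: o_def)
  qed (auto intro: poly_funs.intros)
  assume "reg_at Y (snd x0) \<phi>"
  then obtain f g where fg: "f \<in> poly_funs Y" "g \<in> poly_funs Y" "g (snd x0) \<noteq> 0"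
     "\<forall>x\<in>points Y. g x \<noteq> 0 \<longrightarrow> \<phi> x = f x / g x" unfolding reg_at_def by blast
  show ?thesis unfolding reg_at_def
    by (intro bexI[OF _ *[OF fg(1)]] bexI[OF _ *[OF fg(2)]]) (use fg in \<open>auto simp: points_prod\<close>)
qed

lemma reg_at_B: "reg_at (B n L) x0 (\<lambda>l. l i)"
  by (intro reg_at_poly poly_funs.coord) (auto simp: coords_B)

text \<open>
  A sequence in \<open>B_points n L\<close> that depends rationally on the point \<open>x\<close> of \<open>X\<close> and is defined at \<open>x0\<close>;
  stated for a general parameter variety so that the explicit map can be iterated inside triple products.
\<close>

definition reg_seq_at :: "nat \<Rightarrow> ('a, 'z) variety_scheme \<Rightarrow> 'a \<Rightarrow> real \<Rightarrow> ('a \<Rightarrow> int \<Rightarrow> complex) \<Rightarrow> bool" where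
  "reg_seq_at n X x0 L a \<longleftrightarrow>
     (\<forall>i. reg_at X x0 (\<lambda>x. a x i)) \<and> near X x0 (\<lambda>x. a x \<in> B_points n L)"

lemma generically_point: "generically X P \<Longrightarrow> \<exists>x\<in>points X. P x"
  unfolding generically_iff_near near_def by blast

lemma reg_map_at_BB_iff:
  "reg_map_at X (B n L \<otimes> B n M) x0 F \<longleftrightarrow>
     reg_seq_at n X x0 L (\<lambda>x. fst (F x)) \<and> reg_seq_at n X x0 M (\<lambda>x. snd (F x))"
proof -
  have "near X x0 (\<lambda>x. F x \<in> B_points n L \<times> B_points n M) \<longleftrightarrow>
     near X x0 (\<lambda>x. fst (F x) \<in> B_points n L) \<and> near X x0 (\<lambda>x. snd (F x) \<in> B_points n M)"
    unfolding mem_Times_iff by (blast intro: near_conj near_mono)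
  then show ?thesis
    unfolding reg_map_at_def reg_seq_at_def points_prod points_B coords_BB
    by auto
qed

lemma reg_at_P_poly:
  assumes "\<And>i. reg_at X x0 (\<lambda>x. a x i)" "\<And>i. reg_at X x0 (\<lambda>x. b x i)"
  shows "reg_at X x0 (\<lambda>x. P_poly n (a x) (b x) i)"
  unfolding P_poly_def by (intro reg_at_sum reg_at_mult reg_at_prod assms)

lemma reg_seq_R_explicit:
  assumes x0: "x0 \<in> points X" and a: "reg_seq_at n X x0 L a" and b: "reg_seq_at n X x0 M b"
    and P: "P_nonzero n (a x0, b x0)"
  shows "near X x0 (\<lambda>x. P_nonzero n (a x, b x))"
    and "reg_seq_at n X x0 M (\<lambda>x. fst (R_explicit n (a x, b x)))"
    and "reg_seq_at n X x0 L (\<lambda>x. snd (R_explicit n (a x, b x)))"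
proof -
  have rP: "reg_at X x0 (\<lambda>x. P_poly n (a x) (b x) i)" for i
    using a b by (intro reg_at_P_poly) (auto simp: reg_seq_at_def)
  have nz: "P_poly n (a x0) (b x0) i \<noteq> 0" for i using P by (simp add: P_nonzero_def)
  have pts: "near X x0 (\<lambda>x. a x \<in> B_points n L \<and> b x \<in> B_points n M)"
    using a b by (intro near_conj) (auto simp: reg_seq_at_def)
  have "near X x0 (\<lambda>x. \<forall>i\<in>{0..int n}. P_poly n (a x) (b x) i \<noteq> 0)"
    by (intro near_ball_finite near_nonzero rP nz x0) auto
  from near_conj[OF this pts] show N: "near X x0 (\<lambda>x. P_nonzero n (a x, b x))"
  proof (rule near_mono, elim conjE)
    fix x assume H: "\<forall>i\<in>{0..int n}. P_poly n (a x) (b x) i \<noteq> 0" "a x \<in> B_points n L" "b x \<in> B_points n M"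
    have "periodic n (P_poly n (a x) (b x))" using H by (auto simp: B_points_iff intro: P_poly_periodic)
    then have "P_poly n (a x) (b x) i = P_poly n (a x) (b x) (i mod (int n + 1))" for i
      by (rule periodic_cong) (simp add: cong_def)
    moreover have "i mod (int n + 1) \<in> {0..int n}" for i
      using pos_mod_bound[of "int n + 1" i] by simp
    ultimately have "P_poly n (a x) (b x) i \<noteq> 0" for i using H(1) by metis
    then show "P_nonzero n (a x, b x)" by (simp add: P_nonzero_def)
  qed
  have R: "near X x0 (\<lambda>x. R_explicit n (a x, b x) \<in> B_points n M \<times> B_points n L)"
    by (rule near_mono[OF near_conj[OF N pts]]) (auto intro: R_explicit_in_points)
  have "reg_at X x0 (\<lambda>x. fst (R_explicit n (a x, b x)) i)" "reg_at X x0 (\<lambda>x. snd (R_explicit n (a x, b x)) i)" for i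
    using a b by (auto simp: R_explicit_def reg_seq_at_def intro!: reg_at_divide reg_at_mult rP nz x0)
  then show "reg_seq_at n X x0 M (\<lambda>x. fst (R_explicit n (a x, b x)))"
    and "reg_seq_at n X x0 L (\<lambda>x. snd (R_explicit n (a x, b x)))"
    unfolding reg_seq_at_def by (auto intro: near_mono[OF R])
qed

lemma reg_seq_BB:
  "reg_seq_at n (B n L \<otimes> B n M) x0 L fst" "reg_seq_at n (B n L \<otimes> B n M) x0 M snd"
  unfolding reg_seq_at_def
  by (auto intro: reg_at_fst reg_at_snd reg_at_B intro!: near_points simp: points_prod points_B)

section \<open>Positive points\<close>

text \<open>
  At positive sequences no denominator vanishes: \<open>P_poly\<close> is a sum of
  monomials with positive coefficients, so positivity survives any number of applications of the
  explicit map.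
\<close>

definition pos_seq :: "(int \<Rightarrow> complex) \<Rightarrow> bool" where
  "pos_seq l \<longleftrightarrow> (\<forall>i. \<exists>r > 0. l i = of_real r)"

lemma pos_seq_iff: "pos_seq l \<longleftrightarrow> (\<exists>r. (\<forall>i. r i > 0) \<and> l = (\<lambda>i. of_real (r i)))"
  unfolding pos_seq_def by (auto simp: fun_eq_iff choice_iff)

lemma pos_seq_R_explicit:
  assumes "pos_seq l" "pos_seq m"
  shows "P_nonzero n (l, m)" "pos_seq (fst (R_explicit n (l, m)))" "pos_seq (snd (R_explicit n (l, m)))"
proof -
  obtain r s where r: "\<And>i. r i > 0" "l = (\<lambda>i. of_real (r i))" and s: "\<And>i. s i > 0" "m = (\<lambda>i. of_real (s i))"
    using assms unfolding pos_seq_iff by blast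
  define p where "p i = (\<Sum>k = 1..int n + 1. (\<Prod>j = k..int n + 1. r (i + j)) * (\<Prod>j = 1..k. s (i + j)))" for i
  have p: "p i > 0" for i unfolding p_def
    by (rule sum_pos) (auto intro!: mult_pos_pos prod_pos r s)
  then have pn: "p i \<noteq> 0" for i by (metis less_irrefl)
  have lm: "l i = of_real (r i)" "m i = of_real (s i)" for i by (simp_all add: r(2) s(2))
  have P: "P_poly n l m i = of_real (p i)" for i
    by (simp add: P_poly_def p_def r(2) s(2))
  show "P_nonzero n (l, m)" by (simp add: P_nonzero_def P pn)
  show "pos_seq (fst (R_explicit n (l, m)))"
    unfolding pos_seq_iff
    by (rule exI[of _ "\<lambda>i. s i * (p i / p (i - 1))"]) (simp add: R_explicit_def P lm r(1) s(1) p)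
  show "pos_seq (snd (R_explicit n (l, m)))"
    unfolding pos_seq_iff
    by (rule exI[of _ "\<lambda>i. r i * (p (i - 1) / p i)"]) (simp add: R_explicit_def P lm r(1) s(1) p)
qed

lemma pos_point_exists:
  assumes "L > 0" obtains l where "l \<in> B_points n L" "pos_seq l"
proof
  define l :: "int \<Rightarrow> complex" where "l = (\<lambda>_. of_real (root (n + 1) L))"
  have "nat (int n + 1) = n + 1" by simp
  then have "(\<Prod>j = 1..int n + 1. l j) = of_real (root (n + 1) L ^ (n + 1))"
    by (simp add: l_def del: power_Suc)
  then show "l \<in> B_points n L" using assms
    by (simp add: B_points_iff periodic_def real_root_pow_pos del: power_Suc) (simp add: l_def)
  show "pos_seq l" using assms by (auto simp: pos_seq_def l_def intro!: exI[of _ "root (n + 1) L"])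
qed

lemma generically_P_nonzero:
  assumes "L > 0" "M > 0"
  shows "generically (B n L \<otimes> B n M) (P_nonzero n)"
proof -
  obtain l m where lm: "l \<in> B_points n L" "pos_seq l" "m \<in> B_points n M" "pos_seq m"
    using pos_point_exists assms by metis
  then have "near (B n L \<otimes> B n M) (l, m) (\<lambda>x. P_nonzero n (fst x, snd x))"
    using pos_seq_R_explicit(1) by (intro reg_seq_R_explicit(1)[OF _ reg_seq_BB]) (auto simp: points_prod points_B)
  then show ?thesis unfolding generically_iff_near using lm
    by (intro bexI[of _ "(l, m)"]) (auto simp: points_prod points_B)
qed

section \<open>Birationality of the explicit map\<close>

lemma reg_map_R_explicit:
  assumes "x \<in> points (B n L \<otimes> B n M)" "P_nonzero n x"
  shows "reg_map_at (B n L \<otimes> B n M) (B n M \<otimes> B n L) x (R_explicit n)"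
  using reg_seq_R_explicit(2,3)[OF assms(1) reg_seq_BB] assms(2)
  unfolding reg_map_at_BB_iff by simp

lemma R_explicit_pair:
  assumes "x \<in> points (B n L \<otimes> B n M)" "P_nonzero n x"
  shows "R_explicit n x \<in> points (B n M \<otimes> B n L)" "P_nonzero n (R_explicit n x)"
    "R_explicit n (R_explicit n x) = x"
  using assms R_explicit_in_points R_explicit_involution by (auto simp: points_prod points_B)

lemma R_explicit_dominant:
  assumes "L > 0" "M > 0"
  shows "dominant (B n L \<otimes> B n M) (B n M \<otimes> B n L) (R_explicit n)"
proof (rule dominantI[OF curve_connected_BB generically_P_nonzero[OF assms(2,1)]])
  fix y assume y: "y \<in> points (B n M \<otimes> B n L)" "P_nonzero n y"
  show "\<exists>x\<in>points (B n L \<otimes> B n M). R_explicit n x = y \<and>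
      reg_map_at (B n L \<otimes> B n M) (B n M \<otimes> B n L) x (R_explicit n)"
    using R_explicit_pair[OF y] reg_map_R_explicit by blast
qed

lemma R_explicit_birational:
  assumes "L > 0" "M > 0"
  shows "birational_map (B n L \<otimes> B n M) (B n M \<otimes> B n L) (R_explicit n)"
proof -
  have rat: "rational_map (B n L \<otimes> B n M) (B n M \<otimes> B n L) (R_explicit n)"
    if LM: "L > 0" "M > 0" for L M
  proof -
    obtain x where "x \<in> points (B n L \<otimes> B n M)" "P_nonzero n x"
      using generically_point[OF generically_P_nonzero[OF LM]] by blast
    then show ?thesis by (intro rational_map_reg_map_at reg_map_R_explicit)
  qed
  have inv: "rational_eq (B n L \<otimes> B n M) (R_explicit n \<circ> R_explicit n) id" if "L > 0" "M > 0" for L M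
    unfolding rational_eq_def
    by (rule generically_mono[OF generically_P_nonzero[OF that]]) (simp add: R_explicit_pair(3))
  show ?thesis unfolding birational_map_def
    using rat inv R_explicit_dominant assms by blast
qed

section \<open>Crystal operators on products of two factors\<close>

text \<open>
  The number \<open>c\<^sub>1\<close> in the product crystal, where \<open>\<gamma>\<^sub>i \<epsilon>\<^sub>i\<close> of the first factor is \<open>l\<^sub>i\<close>.
\<close>

definition act_factor :: "int \<Rightarrow> complex \<Rightarrow> (int \<Rightarrow> complex) \<times> (int \<Rightarrow> complex) \<Rightarrow> complex" where
  "act_factor i c x = (c * fst x i + snd x (i + 1)) / (fst x i + snd x (i + 1))"

definition act_regular :: "int \<Rightarrow> complex \<Rightarrow> (int \<Rightarrow> complex) \<times> (int \<Rightarrow> complex) \<Rightarrow> bool" where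
  "act_regular i c x \<longleftrightarrow> fst x i + snd x (i + 1) \<noteq> 0 \<and> c * fst x i + snd x (i + 1) \<noteq> 0"

lemma act_BB:
  assumes "x \<in> points (B n L \<otimes> B n M)"
  shows "act (B n L \<otimes> B n M) i c x =
    (B_act n i (act_factor i c x) (fst x), B_act n i (c / act_factor i c x) (snd x))"
proof -
  have "fst x (i + 1) \<noteq> 0" using assms by (auto simp: points_prod points_B B_points_iff)
  then show ?thesis
    by (simp add: crystal_prod_def prod_act_def B_def act_factor_def Let_def split: prod.split)
       (auto simp: act_factor_def)
qed

lemma eps_BB: "eps (B n L \<otimes> B n M) i x = fst x (i + 1) + snd x (i + 1) / (fst x i / fst x (i + 1))"
  by (simp add: crystal_prod_def B_def split: prod.split)

lemma gam_BB: "gam (B n L \<otimes> B n M) i x = fst x i / fst x (i + 1) * (snd x i / snd x (i + 1))"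
  by (simp add: crystal_prod_def B_def split: prod.split)

lemma not_cong_succ: "n \<ge> 1 \<Longrightarrow> \<not> [i = i + 1] (mod (int n + 1))"
proof
  assume n: "n \<ge> 1" and "[i = i + 1] (mod (int n + 1))"
  then have "int n + 1 dvd 1" by (simp add: cong_iff_dvd_diff)
  then show False using n by (simp add: zdvd1_eq)
qed

lemma B_act_mult:
  assumes "n \<ge> 1"
  shows "B_act n i c l j = (if [j = i] (mod (int n + 1)) then c else 1) *
    (if [j = i + 1] (mod (int n + 1)) then inverse c else 1) * l j"
proof -
  have "\<not> ([j = i] (mod (int n + 1)) \<and> [j = i + 1] (mod (int n + 1)))"
    using not_cong_succ[OF assms, of i] by (meson cong_sym cong_trans)
  then show ?thesis by (auto simp: B_act_def)
qed

lemma prod_residue_class: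
  "(\<Prod>j = 1..int n + 1. if [j = i] (mod (int n + 1)) then c else 1) = (c :: complex)"
proof -
  define k where "k = (i - 1) mod (int n + 1) + 1"
  have k: "k \<in> {1..int n + 1}" unfolding k_def
    using pos_mod_bound[of "int n + 1" "i - 1"] pos_mod_sign[of "int n + 1" "i - 1"] by simp
  have "[j = i] (mod (int n + 1)) \<longleftrightarrow> j = k" if "j \<in> {1..int n + 1}" for j
  proof -
    have "[j = i] (mod (int n + 1)) \<longleftrightarrow> [j - 1 = i - 1] (mod (int n + 1))"
      by (simp add: cong_iff_dvd_diff)
    also have "\<dots> \<longleftrightarrow> j - 1 = (i - 1) mod (int n + 1)"
    proof -
      have "(j - 1) mod (int n + 1) = j - 1" using that by (intro mod_pos_pos_trivial) auto
      then show ?thesis by (simp add: unique_euclidean_semiring_class.cong_def)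
    qed
    finally show ?thesis by (auto simp: k_def)
  qed
  then have "(\<Prod>j = 1..int n + 1. if [j = i] (mod (int n + 1)) then c else 1) =
      (\<Prod>j = 1..int n + 1. if j = k then c else 1)" by (intro prod.cong) auto
  then show ?thesis using k by simp
qed

lemma B_act_in_points:
  assumes n: "n \<ge> 1" and c: "c \<noteq> 0" and l: "l \<in> B_points n L"
  shows "B_act n i c l \<in> B_points n L"
proof -
  have "(\<Prod>j = 1..int n + 1. B_act n i c l j) = of_real L"
    unfolding B_act_mult[OF n] prod.distrib prod_residue_class using l c by (simp add: B_points_iff)
  moreover have "periodic n (B_act n i c l)"
  proof -
    have "[j + (int n + 1) = k] (mod (int n + 1)) \<longleftrightarrow> [j = k] (mod (int n + 1))" for j k
      by (simp only: unique_euclidean_semiring_class.cong_def mod_add_self2)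
    then show ?thesis using l by (simp only: periodic_def B_act_def B_points_iff) simp
  qed
  ultimately show ?thesis using l c by (auto simp: B_points_iff B_act_def)
qed

lemma act_in_points:
  assumes "n \<ge> 1" "c \<noteq> 0" "x \<in> points (B n L \<otimes> B n M)" "act_regular i c x"
  shows "act (B n L \<otimes> B n M) i c x \<in> points (B n L \<otimes> B n M)"
proof -
  have "act_factor i c x \<noteq> 0" using assms by (auto simp: act_factor_def act_regular_def)
  then show ?thesis unfolding act_BB[OF assms(3)] using assms
    by (auto simp: points_prod points_B intro!: B_act_in_points)
qed

text \<open>
  With \<open>u = act_factor i c x\<close>, the two linear forms in \<open>act_regular\<close> are exchanged by the action
  up to the nonzero factor \<open>u / c\<close>.
\<close>

lemma act_regular_act:
  assumes n: "n \<ge> 1" and c: "c \<noteq> 0" and x: "x \<in> points (B n L \<otimes> B n M)" and N: "act_regular i c x"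
  shows "act_regular i (1 / c) (act (B n L \<otimes> B n M) i c x)"
    and "act (B n L \<otimes> B n M) i (1 / c) (act (B n L \<otimes> B n M) i c x) = x"
proof -
  define u where "u = act_factor i c x"
  have u: "u \<noteq> 0" using N by (auto simp: u_def act_factor_def act_regular_def)
  define y where "y = act (B n L \<otimes> B n M) i c x"
  have y: "y = (B_act n i u (fst x), B_act n i (c / u) (snd x))"
    unfolding y_def act_BB[OF x] u_def ..
  have y1: "fst y i = u * fst x i" and y2: "snd y (i + 1) = u / c * snd x (i + 1)"
    using not_cong_succ[OF n, of i] by (auto simp: y B_act_mult[OF n] cong_sym_eq)
  have e1: "fst y i + snd y (i + 1) = u / c * (c * fst x i + snd x (i + 1))"
    and e2: "1 / c * fst y i + snd y (i + 1) = u / c * (fst x i + snd x (i + 1))"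
    using c unfolding y1 y2 by (simp_all add: field_simps)
  show "act_regular i (1 / c) y" unfolding act_regular_def e1 e2 using N u c by (simp add: act_regular_def)
  have f: "act_factor i (1 / c) y = 1 / u"
  proof -
    have "1 / u = (fst x i + snd x (i + 1)) / (c * fst x i + snd x (i + 1))"
      by (simp add: u_def act_factor_def)
    then show ?thesis unfolding act_factor_def e1 e2 using u c by simp
  qed
  have yp: "y \<in> points (B n L \<otimes> B n M)" unfolding y_def by (rule act_in_points[OF n c x N])
  have inv: "B_act n i a (B_act n i b l) = l" if "a * b = 1" for a b l
    using that unfolding fun_eq_iff B_act_def
    by (auto simp: mult.assoc[symmetric] inverse_mult_distrib[symmetric] mult.commute)
  show "act (B n L \<otimes> B n M) i (1 / c) y = x"
    unfolding act_BB[OF yp] f unfolding y using u c by (simp add: inv)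
qed

text \<open>
  A nonvanishing point of \<open>a l\<^sub>i + m\<^sub>i\<^sub>+\<^sub>1\<close> is found by halving \<open>m\<^sub>i\<^sub>+\<^sub>1\<close>: the form cannot vanish both
  before and after.
\<close>

lemma generically_act_regular:
  assumes n: "n \<ge> 1" and "L > 0" "M > 0"
  shows "generically (B n L \<otimes> B n M) (act_regular i c)"
proof -
  let ?X = "B n L \<otimes> B n M"
  have *: "generically ?X (\<lambda>x. a * fst x i + snd x (i + 1) \<noteq> 0)" for a
  proof -
    obtain l m where l: "l \<in> B_points n L" and m: "m \<in> B_points n M"
      using pos_point_exists assms(2,3) by metis
    define m' where "m' = B_act n i 2 m"
    have m': "m' \<in> B_points n M" unfolding m'_def by (rule B_act_in_points[OF n _ m]) simp
    have m1: "m' (i + 1) = m (i + 1) / 2" "m (i + 1) \<noteq> 0"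
      using not_cong_succ[OF n, of i] m
      by (auto simp: m'_def B_act_mult[OF n] cong_sym_eq B_points_iff)
    have "\<exists>x\<in>points ?X. a * fst x i + snd x (i + 1) \<noteq> 0"
    proof (cases "a * l i + m (i + 1) = 0")
      case True
      then have "a * l i = - m (i + 1)" by (simp add: eq_neg_iff_add_eq_0)
      then have e: "a * l i + m' (i + 1) = - (m (i + 1) / 2)" unfolding m1(1) by (simp add: field_simps)
      have "a * l i + m' (i + 1) \<noteq> 0" unfolding e using m1(2) by simp
      then show ?thesis using l m' by (intro bexI[of _ "(l, m')"]) (auto simp: points_prod points_B)
    next
      case False
      then show ?thesis using l m by (intro bexI[of _ "(l, m)"]) (auto simp: points_prod points_B)
    qed
    then obtain x where x: "x \<in> points ?X" "a * fst x i + snd x (i + 1) \<noteq> 0" by blast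
    then have "near ?X x (\<lambda>x. a * fst x i + snd x (i + 1) \<noteq> 0)"
      by (intro near_nonzero reg_at_add reg_at_mult reg_at_const reg_at_fst reg_at_snd reg_at_B)
    then show ?thesis using x unfolding generically_iff_near by blast
  qed
  have "generically ?X (\<lambda>x. 1 * fst x i + snd x (i + 1) \<noteq> 0 \<and> c * fst x i + snd x (i + 1) \<noteq> 0)"
    by (intro generically_conj[OF curve_connected_BB] *)
  then show ?thesis by (rule generically_mono) (simp add: act_regular_def)
qed

lemma reg_map_act:
  assumes n: "n \<ge> 1" and c: "c \<noteq> 0" and x: "x \<in> points (B n L \<otimes> B n M)" and N: "act_regular i c x"
  shows "reg_map_at (B n L \<otimes> B n M) (B n L \<otimes> B n M) x (act (B n L \<otimes> B n M) i c)"
proof -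
  let ?X = "B n L \<otimes> B n M"
  let ?u = "act_factor i c"
  have r1: "reg_at ?X x (\<lambda>x. fst x j)" and r2: "reg_at ?X x (\<lambda>x. snd x j)" for j
    by (auto intro: reg_at_fst reg_at_snd reg_at_B)
  have u0: "?u x \<noteq> 0" using N by (auto simp: act_factor_def act_regular_def)
  have d0: "fst x i + snd x (i + 1) \<noteq> 0" using N by (simp add: act_regular_def)
  have ru: "reg_at ?X x ?u" unfolding act_factor_def
    by (intro reg_at_divide reg_at_add reg_at_mult reg_at_const r1 r2 d0 x)
  have reg_act: "reg_at ?X x (\<lambda>x. B_act n i (v x) (a x) j)"
    if "reg_at ?X x v" "v x \<noteq> 0" "reg_at ?X x (\<lambda>x. a x j)" for v a j
  proof -
    have "reg_at ?X x (\<lambda>x. 1 / v x)" by (intro reg_at_divide reg_at_const that x)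
    then have "reg_at ?X x (\<lambda>x. inverse (v x) * a x j)"
      using reg_at_mult[of _ _ "\<lambda>x. 1 / v x", OF _ that(3)] by (simp add: inverse_eq_divide)
    moreover have "reg_at ?X x (\<lambda>x. v x * a x j)" by (intro reg_at_mult that)
    ultimately show ?thesis unfolding B_act_def using that(3)
      by (cases "[j = i] (mod (int n + 1))"; cases "[j = i + 1] (mod (int n + 1))") simp_all
  qed
  have "near ?X x (\<lambda>x. fst x i + snd x (i + 1) \<noteq> 0 \<and> ?u x \<noteq> 0)"
    by (intro near_conj near_nonzero ru u0 d0 x reg_at_add r1 r2)
  then have "near ?X x (\<lambda>x. act ?X i c x \<in> points ?X)"
    by (rule near_mono) (rule act_in_points[OF n c], auto simp: act_regular_def act_factor_def)
  moreover have "reg_at ?X x (\<lambda>x. fst (act ?X i c x) j)" for j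
    by (rule reg_at_cong[OF reg_act[OF ru u0 r1]]) (rule near_points, simp add: act_BB)
  moreover have "reg_at ?X x (\<lambda>x. snd (act ?X i c x) j)" for j
  proof (rule reg_at_cong[OF reg_act[OF _ _ r2]])
    show "reg_at ?X x (\<lambda>x. c / ?u x)" by (intro reg_at_divide reg_at_const ru u0 x)
    show "c / ?u x \<noteq> 0" using c u0 by simp
  qed (rule near_points, simp add: act_BB)
  ultimately show ?thesis unfolding reg_map_at_def coords_BB by auto
qed

lemma act_dominant:
  assumes n: "n \<ge> 1" and c: "c \<noteq> 0" and "L > 0" "M > 0"
  shows "dominant (B n L \<otimes> B n M) (B n L \<otimes> B n M) (act (B n L \<otimes> B n M) i c)"
proof (rule dominantI[OF curve_connected_BB generically_act_regular[OF n assms(3,4), of i "1 / c"]])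
  fix y assume y: "y \<in> points (B n L \<otimes> B n M)" "act_regular i (1 / c) y"
  have c': "1 / c \<noteq> 0" using c by simp
  show "\<exists>x\<in>points (B n L \<otimes> B n M). act (B n L \<otimes> B n M) i c x = y \<and>
      reg_map_at (B n L \<otimes> B n M) (B n L \<otimes> B n M) x (act (B n L \<otimes> B n M) i c)"
    using act_in_points[OF n c' y] act_regular_act[OF n c' y] reg_map_act[OF n c]
    by (intro bexI[of _ "act (B n L \<otimes> B n M) i (1 / c) y"]) auto
qed

section \<open>Compatibility with the crystal structure\<close>

text \<open>
  The functions \<open>\<gamma>\<^sub>i\<close> and \<open>\<epsilon>\<^sub>i\<close> are expressions in these quantities; conversely, \<open>\<gamma>\<close> yields the products
  only up to a common factor.
\<close>

definition same_invariants ::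
  "(int \<Rightarrow> complex) \<times> (int \<Rightarrow> complex) \<Rightarrow> (int \<Rightarrow> complex) \<times> (int \<Rightarrow> complex) \<Rightarrow> bool" where
  "same_invariants x y \<longleftrightarrow> (\<forall>i. fst y i * snd y i = fst x i * snd x i) \<and>
     (\<forall>i. 1 / fst y i + 1 / snd y (i + 1) = 1 / fst x i + 1 / snd x (i + 1))"

lemma R_explicit_same_invariants:
  assumes "x \<in> points (B n L \<otimes> B n M)" "P_nonzero n x"
  shows "same_invariants x (R_explicit n x)"
proof -
  obtain l m l' m' where x: "x = (l, m)" and R: "R_explicit n (l, m) = (l', m')" by fastforce
  have "l \<in> B_points n L" "m \<in> B_points n M" "P_nonzero n (l, m)"
    using assms by (auto simp: x points_prod points_B)
  from R_explicit_invariants[OF this R] show ?thesis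
    unfolding same_invariants_def x R by simp
qed

lemma R_explicit_eqI:
  assumes "x \<in> points (B n L \<otimes> B n M)" "P_nonzero n x" "y \<in> points (B n M \<otimes> B n L)" "same_invariants x y"
  shows "y = R_explicit n x"
  using R_explicit_unique[of "fst x" n L "snd x" M "fst y" "snd y"] assms
  by (auto simp: points_prod points_B same_invariants_def)

lemma eps_BB_invariants:
  assumes "x \<in> points (B n L \<otimes> B n M)"
  shows "eps (B n L \<otimes> B n M) i x =
    fst x (i + 1) * snd x (i + 1) * (1 / fst x i + 1 / snd x (i + 1))"
proof -
  have "fst x j \<noteq> 0" "snd x j \<noteq> 0" for j using assms by (auto simp: points_prod points_B B_points_iff)
  then show ?thesis by (simp add: eps_BB field_simps)
qed

lemma gam_BB_invariants:
  "gam (B n L \<otimes> B n M) i x = (fst x i * snd x i) / (fst x (i + 1) * snd x (i + 1))"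
  by (simp add: gam_BB)

text \<open>
  Although \<open>act_factor\<close> itself is not a function of the invariants, it enters only through
  \<open>u / l\<^sub>i\<^sub>+\<^sub>1\<close> and \<open>u / (c m\<^sub>i)\<close>, which differ from \<open>1 / l\<^sub>i\<^sub>+\<^sub>1\<close> and \<open>1 / m\<^sub>i\<close> by functions of the
  invariants; at \<open>i\<close> itself it cancels. The form with added corrections covers \<open>n = 1\<close>, where
  \<open>i - 1\<close> and \<open>i + 1\<close> are congruent and both corrections occur.
\<close>

lemma act_invariants:
  assumes n: "n \<ge> 1" and c: "c \<noteq> 0" and x: "x \<in> points (B n L \<otimes> B n M)" and N: "act_regular i c x"
    and y: "y = act (B n L \<otimes> B n M) i c x" and s: "s = 1 / fst x i + 1 / snd x (i + 1)"
  shows "fst y j * snd y j = B_act n i c (\<lambda>j. fst x j * snd x j) j"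
    and "1 / fst y j + 1 / snd y (j + 1) =
      (if [j = i] (mod (int n + 1)) then s
       else 1 / fst x j + 1 / snd x (j + 1)
         + (if [j = i + 1] (mod (int n + 1)) then (c - 1) / (s * (fst x j * snd x j)) else 0)
         + (if [j + 1 = i] (mod (int n + 1)) then (1 - c) / (c * s * (fst x (j + 1) * snd x (j + 1))) else 0))"
proof -
  define u where "u = act_factor i c x"
  obtain l m where lm: "x = (l, m)" by fastforce
  have nz: "l j \<noteq> 0" "m j \<noteq> 0" for j using x by (auto simp: lm points_prod points_B B_points_iff)
  have per: "periodic n l" "periodic n m" using x by (auto simp: lm points_prod points_B B_points_iff)
  have N': "l i + m (i + 1) \<noteq> 0" "c * l i + m (i + 1) \<noteq> 0" using N by (auto simp: lm act_regular_def)
  have u: "u = (c * l i + m (i + 1)) / (l i + m (i + 1))" by (simp add: u_def act_factor_def lm)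
  have u0: "u \<noteq> 0" using N' by (simp add: u)
  have y': "fst y j = B_act n i u l j" "snd y j = B_act n i (c / u) m j" for j
    using act_BB[OF x, of i c] by (simp_all add: y u_def lm)
  show "fst y j * snd y j = B_act n i c (\<lambda>j. fst x j * snd x j) j"
    using u0 c unfolding y' lm by (simp add: B_act_mult[OF n] inverse_eq_divide)
  have s': "s = (l i + m (i + 1)) / (l i * m (i + 1))" using nz by (simp add: s lm field_simps)
  have j1: "[j + 1 = i + 1] (mod (int n + 1)) \<longleftrightarrow> [j = i] (mod (int n + 1))"
    by (simp add: cong_iff_dvd_diff)
  have cyc: "l j = l i" "m (j + 1) = m (i + 1)" if "[j = i] (mod (int n + 1))"
    using that j1 periodic_cong per by blast+
  have cyc1: "l j = l (i + 1)" "m j = m (i + 1)" if "[j = i + 1] (mod (int n + 1))"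
    using that periodic_cong per by blast+
  have cyc2: "m (j + 1) = m i" "l (j + 1) = l i" if "[j + 1 = i] (mod (int n + 1))"
    using that periodic_cong per by blast+
  show "1 / fst y j + 1 / snd y (j + 1) =
      (if [j = i] (mod (int n + 1)) then s
       else 1 / fst x j + 1 / snd x (j + 1)
         + (if [j = i + 1] (mod (int n + 1)) then (c - 1) / (s * (fst x j * snd x j)) else 0)
         + (if [j + 1 = i] (mod (int n + 1)) then (1 - c) / (c * s * (fst x (j + 1) * snd x (j + 1))) else 0))"
  proof (cases "[j = i] (mod (int n + 1))")
    case True
    have "\<not> [j = i + 1] (mod (int n + 1))" "\<not> [j + 1 = i] (mod (int n + 1))"
      using True not_cong_succ[OF n, of i] not_cong_succ[OF n, of j] by (meson cong_sym cong_trans)+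
    then have "1 / fst y j + 1 / snd y (j + 1) = 1 / (u * l i) + c / (u * m (i + 1))"
      using True cyc[OF True] j1 unfolding y' by (simp add: B_act_mult[OF n])
    also have "\<dots> = (c * l i + m (i + 1)) / (u * (l i * m (i + 1)))"
      using u0 nz[of i] nz[of "i + 1"] by (simp add: divide_simps)
    also have "\<dots> = s" unfolding s' u using N' by simp
    finally show ?thesis using True by simp
  next
    case False
    have 1: "1 / fst y j = 1 / l j + (if [j = i + 1] (mod (int n + 1)) then (c - 1) / (s * (l j * m j)) else 0)"
    proof (cases "[j = i + 1] (mod (int n + 1))")
      case True
      then have "1 / fst y j = u / l j" using False unfolding y' by (simp add: B_act_mult[OF n] field_simps)
      moreover have "u = 1 + (c - 1) / (s * m j)"
        unfolding u s' cyc1[OF True] using N' nz[of i] nz[of "i + 1"]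
        by (simp add: divide_simps) (simp add: algebra_simps)
      ultimately show ?thesis using True nz[of j] by (simp add: add_divide_distrib)
    next
      case F: False
      then show ?thesis using False unfolding y' by (simp add: B_act_mult[OF n])
    qed
    have 2: "1 / snd y (j + 1) = 1 / m (j + 1) +
      (if [j + 1 = i] (mod (int n + 1)) then (1 - c) / (c * s * (l (j + 1) * m (j + 1))) else 0)"
    proof (cases "[j + 1 = i] (mod (int n + 1))")
      case True
      then have "1 / snd y (j + 1) = (u / c) / m (j + 1)" using False j1 unfolding y' by (simp add: B_act_mult[OF n])
      moreover have "u / c = 1 + (1 - c) / (c * s * l (j + 1))"
        unfolding u s' cyc2[OF True] using N' nz[of i] nz[of "i + 1"] c
        by (simp add: divide_simps) (simp add: algebra_simps)
      ultimately show ?thesis using True nz[of "j + 1"] by (simp add: add_divide_distrib)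
    next
      case F: False
      then show ?thesis using False j1 unfolding y' by (simp add: B_act_mult[OF n])
    qed
    show ?thesis unfolding 1 2 using False by (simp add: lm)
  qed
qed

lemma act_same_invariants:
  assumes n: "n \<ge> 1" and c: "c \<noteq> 0" and x: "x \<in> points (B n L \<otimes> B n M)" "act_regular i c x"
    and y: "y \<in> points (B n M \<otimes> B n L)" "act_regular i c y" and inv: "same_invariants x y"
  shows "same_invariants (act (B n L \<otimes> B n M) i c x) (act (B n M \<otimes> B n L) i c y)"
proof -
  have b: "fst y j * snd y j = fst x j * snd x j" 
    and s: "1 / fst y j + 1 / snd y (j + 1) = 1 / fst x j + 1 / snd x (j + 1)" for j
    using inv by (auto simp: same_invariants_def)
  show ?thesis
    unfolding same_invariants_def act_invariants[OF n c x refl refl] act_invariants[OF n c y refl refl] b s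
    by simp
qed

lemma R_explicit_crystal_compatible:
  assumes n: "n \<ge> 1" and L: "L > 0" "M > 0"
  shows "crystal_compatible n (B n L \<otimes> B n M) (B n M \<otimes> B n L) (R_explicit n)"
proof -
  let ?X = "B n L \<otimes> B n M" and ?Y = "B n M \<otimes> B n L"
  note conj = generically_conj[OF curve_connected_BB]
  have "rational_eq ?X (act ?Y i c \<circ> R_explicit n) (R_explicit n \<circ> act ?X i c)" if c: "c \<noteq> 0" for i c
  proof -
    have "generically ?X (\<lambda>x. P_nonzero n x \<and> act_regular i c x \<and> P_nonzero n (act ?X i c x) \<and> act_regular i c (R_explicit n x))"
      by (intro conj generically_P_nonzero L generically_act_regular[OF n]
          generically_dominant[OF act_dominant[OF n c]] generically_dominant[OF R_explicit_dominant])
    then show ?thesis unfolding rational_eq_def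
    proof (rule generically_mono, elim conjE)
      fix x assume x: "x \<in> points ?X" "P_nonzero n x" "act_regular i c x" "P_nonzero n (act ?X i c x)"
        "act_regular i c (R_explicit n x)"
      note y = R_explicit_pair(1)[OF x(1,2)]
      have "act ?Y i c (R_explicit n x) = R_explicit n (act ?X i c x)"
        by (rule R_explicit_eqI[OF act_in_points[OF n c x(1,3)] x(4) act_in_points[OF n c y x(5)]
              act_same_invariants[OF n c x(1,3) y x(5) R_explicit_same_invariants[OF x(1,2)]]])
      then show "(act ?Y i c \<circ> R_explicit n) x = (R_explicit n \<circ> act ?X i c) x" by simp
    qed
  qed
  moreover have "rational_eq ?X (eps ?X i) (eps ?Y i \<circ> R_explicit n)" for i
    unfolding rational_eq_def
  proof (rule generically_mono[OF generically_P_nonzero[OF L]])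
    fix x assume x: "x \<in> points ?X" "P_nonzero n x"
    show "eps ?X i x = (eps ?Y i \<circ> R_explicit n) x"
      using R_explicit_same_invariants[OF x] eps_BB_invariants[OF x(1)]
        eps_BB_invariants[OF R_explicit_pair(1)[OF x]] by (simp add: same_invariants_def)
  qed
  moreover have "rational_eq ?X (gam ?X i) (gam ?Y i \<circ> R_explicit n)" for i
    unfolding rational_eq_def
  proof (rule generically_mono[OF generically_P_nonzero[OF L]])
    fix x assume x: "x \<in> points ?X" "P_nonzero n x"
    show "gam ?X i x = (gam ?Y i \<circ> R_explicit n) x"
      using R_explicit_same_invariants[OF x]
      by (simp add: gam_BB_invariants same_invariants_def)
  qed
  ultimately show ?thesis unfolding crystal_compatible_def by blast
qed

section \<open>Yang-Baxter equation for rational maps\<close>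

text \<open>
  All denominators are nonzero at a triple of positive sequences, hence near it, and there the
  pointwise equation applies.
\<close>

lemma R_explicit_yang_baxter:
  assumes L: "L > 0" "M > 0" "K > 0"
  shows "rational_eq (B n L \<otimes> B n M \<otimes> B n K)
      (times_id (R_explicit n) \<circ> id_times (R_explicit n) \<circ> times_id (R_explicit n))
      (id_times (R_explicit n) \<circ> times_id (R_explicit n) \<circ> id_times (R_explicit n))"
proof -
  let ?X = "B n L \<otimes> B n M \<otimes> B n K" and ?R = "R_explicit n"
  obtain l0 m0 k0 where p: "l0 \<in> B_points n L" "pos_seq l0" "m0 \<in> B_points n M" "pos_seq m0"
    "k0 \<in> B_points n K" "pos_seq k0"
    using pos_point_exists L by metis
  define x0 where "x0 = (l0, m0, k0)"
  have x0: "x0 \<in> points ?X" using p by (simp add: x0_def points_prod points_B)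
  define good where "good L a \<longleftrightarrow> reg_seq_at n ?X x0 L a \<and> pos_seq (a x0)" for L a
  have step: "near ?X x0 (\<lambda>x. P_nonzero n (a x, b x)) \<and> good M (\<lambda>x. fst (?R (a x, b x))) \<and>
      good L (\<lambda>x. snd (?R (a x, b x)))" if "good L a" "good M b" for a b L M
    using that reg_seq_R_explicit[OF x0, of n L a M b] pos_seq_R_explicit[of "a x0" "b x0"]
    unfolding good_def by blast
  have reg0: "reg_seq_at n ?X x0 L fst" "reg_seq_at n ?X x0 M (\<lambda>x. fst (snd x))"
    "reg_seq_at n ?X x0 K (\<lambda>x. snd (snd x))"
    unfolding reg_seq_at_def
    by (auto intro!: near_points reg_at_fst reg_at_snd[where \<phi> = "\<lambda>x. fst x _"]
        reg_at_snd[where \<phi> = "\<lambda>x. snd x _"] reg_at_snd reg_at_B simp: points_prod points_B)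
  then have good0: "good L fst" "good M (\<lambda>x. fst (snd x))" "good K (\<lambda>x. snd (snd x))"
    using p by (auto simp: good_def x0_def)
  define a1 where "a1 x = ?R (fst x, fst (snd x))" for x :: "(int \<Rightarrow> complex) \<times> (int \<Rightarrow> complex) \<times> (int \<Rightarrow> complex)"
  define a2 where "a2 x = ?R (snd (a1 x), snd (snd x))" for x
  define c1 where "c1 x = ?R (fst (snd x), snd (snd x))" for x :: "(int \<Rightarrow> complex) \<times> (int \<Rightarrow> complex) \<times> (int \<Rightarrow> complex)"
  define c2 where "c2 x = ?R (fst x, fst (c1 x))" for x
  note A1 = step[OF good0(1,2), folded a1_def]
  note A2 = step[OF conjunct2[OF conjunct2[OF A1]] good0(3), folded a2_def]
  note A3 = step[OF conjunct1[OF conjunct2[OF A1]] conjunct1[OF conjunct2[OF A2]]]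
  note C1 = step[OF good0(2,3), folded c1_def]
  note C2 = step[OF good0(1) conjunct1[OF conjunct2[OF C1]], folded c2_def]
  note C3 = step[OF conjunct2[OF conjunct2[OF C2]] conjunct2[OF conjunct2[OF C1]]]
  have "near ?X x0 (\<lambda>x. P_nonzero n (fst x, fst (snd x)) \<and> P_nonzero n (snd (a1 x), snd (snd x)) \<and>
      P_nonzero n (fst (a1 x), fst (a2 x)) \<and> P_nonzero n (fst (snd x), snd (snd x)) \<and>
      P_nonzero n (fst x, fst (c1 x)) \<and> P_nonzero n (snd (c2 x), snd (c1 x)))"
    using A1 A2 A3 C1 C2 C3 by (intro near_conj) blast+
  then have "near ?X x0 (\<lambda>x. (times_id ?R \<circ> id_times ?R \<circ> times_id ?R) x =
      (id_times ?R \<circ> times_id ?R \<circ> id_times ?R) x)"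
  proof (rule near_mono, elim conjE)
    fix x assume x: "x \<in> points ?X" and
      P: "P_nonzero n (fst x, fst (snd x))" "P_nonzero n (snd (a1 x), snd (snd x))"
      "P_nonzero n (fst (a1 x), fst (a2 x))" "P_nonzero n (fst (snd x), snd (snd x))"
      "P_nonzero n (fst x, fst (c1 x))" "P_nonzero n (snd (c2 x), snd (c1 x))"
    obtain l m k where lmk: "x = (l, m, k)" by (metis prod.exhaust)
    have pts: "l \<in> B_points n L" "m \<in> B_points n M" "k \<in> B_points n K"
      using x by (auto simp: lmk points_prod points_B)
    obtain m1 l1 where e1: "?R (l, m) = (m1, l1)" by fastforce
    obtain k1 l2 where e2: "?R (l1, k) = (k1, l2)" by fastforce
    obtain k2 m2 where e3: "?R (m1, k1) = (k2, m2)" by fastforce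
    obtain k3 m3 where e4: "?R (m, k) = (k3, m3)" by fastforce
    obtain k4 l3 where e5: "?R (l, k3) = (k4, l3)" by fastforce
    obtain m4 l4 where e6: "?R (l3, m3) = (m4, l4)" by fastforce
    have a: "a1 x = (m1, l1)" "a2 x = (k1, l2)" "c1 x = (k3, m3)" "c2 x = (k4, l3)"
      by (simp_all add: a1_def a2_def c1_def c2_def lmk e1 e2 e4 e5)
    have nz: "L \<noteq> 0" "M \<noteq> 0" "K \<noteq> 0" using L by auto
    have "(k2, m2, l2) = (k4, m4, l4)"
      using P unfolding a unfolding lmk
      by (intro yang_baxter_pointwise[OF pts nz _ e1 _ e2 _ e3 _ e4 _ e5 _ e6]) simp_all
    then show "(times_id ?R \<circ> id_times ?R \<circ> times_id ?R) x = (id_times ?R \<circ> times_id ?R \<circ> id_times ?R) x"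
      by (simp add: lmk times_id_def id_times_def e1 e2 e3 e4 e5 e6)
  qed
  then show ?thesis unfolding rational_eq_def generically_iff_near using x0 by blast
qed

section \<open>Uniqueness among crystal morphisms\<close>

text \<open>
  The quadratic dependence on \<open>c\<close>: \<open>act_factor\<close> equals \<open>c + (1 - c) r\<close>. The coefficient \<open>q\<close> is
  nonzero only for \<open>n = 1\<close>, when the operator also changes \<open>l\<^sub>i\<^sub>-\<^sub>1\<close>.
\<close>

lemma eps_act_expansion:
  assumes n: "n \<ge> 1" and c: "c \<noteq> 0" and x: "x \<in> points (B n L \<otimes> B n M)" and N: "act_regular i c x"
    and r: "r = snd x (i + 1) / (fst x i + snd x (i + 1))"
    and q: "q = (if [i - 1 = i + 1] (mod (int n + 1))
      then snd x i * fst x i / fst x (i - 1) * (1 - r) else 0)"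
  shows "eps (B n L \<otimes> B n M) (i - 1) (act (B n L \<otimes> B n M) i c x) =
    c * eps (B n L \<otimes> B n M) (i - 1) x + (1 - c) * (fst x i * r) + c * (c - 1) * q"
proof -
  define u where "u = act_factor i c x"
  obtain l m where lm: "x = (l, m)" by fastforce
  have nz: "l j \<noteq> 0" "m j \<noteq> 0" for j using x by (auto simp: lm points_prod points_B B_points_iff)
  have N': "l i + m (i + 1) \<noteq> 0" "c * l i + m (i + 1) \<noteq> 0" using N by (auto simp: lm act_regular_def)
  have u': "u = (c * l i + m (i + 1)) / (l i + m (i + 1))" by (simp add: u_def act_factor_def lm)
  have u0: "u \<noteq> 0" using N' by (simp add: u')
  have u: "u = c + (1 - c) * r" using N' by (simp add: u' r lm field_simps)
  have ne: "\<not> [i - 1 = i] (mod (int n + 1))" "\<not> [i = i + 1] (mod (int n + 1))"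
    using not_cong_succ[OF n, of "i - 1"] not_cong_succ[OF n, of i] by auto
  have "eps (B n L \<otimes> B n M) (i - 1) (act (B n L \<otimes> B n M) i c x) =
    u * l i + c * m i * l i / B_act n i u l (i - 1)"
    unfolding eps_BB act_BB[OF x] u_def[symmetric] using ne u0 by (simp add: lm B_act_mult[OF n])
  also have "c * m i * l i / B_act n i u l (i - 1) =
    (if [i - 1 = i + 1] (mod (int n + 1)) then u else 1) * c * m i * l i / l (i - 1)"
    using ne u0 by (simp add: B_act_mult[OF n] field_simps)
  also have "u * l i + \<dots> = c * (l i + m i / (l (i - 1) / l i)) + (1 - c) * (l i * r) + c * (c - 1) * q"
    using nz[of "i - 1"] unfolding q u by (simp add: lm field_simps)
  finally show ?thesis by (simp add: eps_BB lm)
qed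

text \<open>
  For a quadratic polynomial \<open>p\<close> one has \<open>p(0) = p(1) + (p(-1) - p(2)) / 3\<close>. Applied to
  \<open>p(c) = \<epsilon>\<^sub>i\<^sub>-\<^sub>1(e\<^sub>i\<^sup>c x)\<close>, whose constant term is \<open>l\<^sub>i m\<^sub>i\<^sub>+\<^sub>1 / (l\<^sub>i + m\<^sub>i\<^sub>+\<^sub>1)\<close>, it expresses the
  product \<open>l\<^sub>i\<^sub>+\<^sub>1 m\<^sub>i\<^sub>+\<^sub>1\<close> by crystal data that every crystal morphism preserves.
\<close>

lemma product_from_eps:
  assumes n: "n \<ge> 1" and x: "x \<in> points (B n L \<otimes> B n M)"
    and N: "act_regular i (-1) x" "act_regular i 2 x"
  shows "fst x (i + 1) * snd x (i + 1) = eps (B n L \<otimes> B n M) i x *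
    (eps (B n L \<otimes> B n M) (i - 1) x +
      (eps (B n L \<otimes> B n M) (i - 1) (act (B n L \<otimes> B n M) i (-1) x)
        - eps (B n L \<otimes> B n M) (i - 1) (act (B n L \<otimes> B n M) i 2 x)) / 3)"
proof -
  define r where "r = snd x (i + 1) / (fst x i + snd x (i + 1))"
  have nz: "fst x j \<noteq> 0" "snd x j \<noteq> 0" for j using x by (auto simp: points_prod points_B B_points_iff)
  have d: "fst x i + snd x (i + 1) \<noteq> 0" using N by (simp add: act_regular_def)
  have "eps (B n L \<otimes> B n M) (i - 1) x +
      (eps (B n L \<otimes> B n M) (i - 1) (act (B n L \<otimes> B n M) i (-1) x)
        - eps (B n L \<otimes> B n M) (i - 1) (act (B n L \<otimes> B n M) i 2 x)) / 3 = fst x i * r"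
    unfolding eps_act_expansion[OF n _ x N(1) r_def refl, simplified]
      eps_act_expansion[OF n _ x N(2) r_def refl, simplified] by (simp add: field_simps)
  moreover have "eps (B n L \<otimes> B n M) i x * (fst x i * r) = fst x (i + 1) * snd x (i + 1)"
    using nz[of i] nz[of "i + 1"] d unfolding r_def eps_BB by (simp add: divide_simps) (simp add: algebra_simps)
  ultimately show ?thesis by simp
qed

lemma all_from_period:
  assumes "\<And>j. f (j + (int n + 1)) = (f j :: complex)" "\<And>j. g (j + (int n + 1)) = g j"
    "\<forall>j\<in>{0..int n}. f j = g j"
  shows "f j = g j"
proof -
  have "f j = f (j mod (int n + 1))" "g j = g (j mod (int n + 1))"
    using assms(1,2) by (auto intro!: periodic_cong[of n] simp: periodic_def unique_euclidean_semiring_class.cong_def)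
  moreover have "j mod (int n + 1) \<in> {0..int n}"
    using pos_mod_bound[of "int n + 1" j] pos_mod_sign[of "int n + 1" j] by simp
  ultimately show ?thesis using assms(3) by metis
qed

lemma BB_shift:
  assumes "x \<in> points (B n L \<otimes> B n M)"
  shows "fst x (j + (int n + 1)) = fst x j" "snd x (j + (int n + 1)) = snd x j"
    "fst x (j + (int n + 1) + 1) = fst x (j + 1)" "snd x (j + (int n + 1) + 1) = snd x (j + 1)"
  using assms periodicD[of n _ j] periodicD[of n _ "j + 1"]
  by (auto simp: points_prod points_B B_points_iff algebra_simps)

lemma eps_gam_shift:
  assumes "x \<in> points (B n L \<otimes> B n M)"
  shows "eps (B n L \<otimes> B n M) (j + (int n + 1)) x = eps (B n L \<otimes> B n M) j x"
    "gam (B n L \<otimes> B n M) (j + (int n + 1)) x = gam (B n L \<otimes> B n M) j x"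
  by (simp_all only: eps_BB gam_BB BB_shift[OF assms])

text \<open>
  The functions \<open>\<gamma>\<^sub>i\<close> are the ratios of consecutive products \<open>l\<^sub>i m\<^sub>i\<close>, so agreement of the products at
  a single index \<open>k\<close> spreads to all indices.
\<close>

lemma same_invariantsI:
  assumes x: "x \<in> points (B n L \<otimes> B n M)" and y: "y \<in> points (B n M \<otimes> B n L)"
    and eps: "\<forall>i\<in>{0..int n}. eps (B n L \<otimes> B n M) i x = eps (B n M \<otimes> B n L) i y"
    and gam: "\<forall>i\<in>{0..int n}. gam (B n L \<otimes> B n M) i x = gam (B n M \<otimes> B n L) i y"
    and k: "fst y k * snd y k = fst x k * snd x k"
  shows "same_invariants x y"
proof -
  have nz: "fst x j \<noteq> 0" "snd x j \<noteq> 0" "fst y j \<noteq> 0" "snd y j \<noteq> 0" for j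
    using x y by (auto simp: points_prod points_B B_points_iff)
  have eps: "eps (B n L \<otimes> B n M) j x = eps (B n M \<otimes> B n L) j y" for j
    by (rule all_from_period[OF eps_gam_shift(1)[OF x] eps_gam_shift(1)[OF y] eps])
  have gam: "gam (B n L \<otimes> B n M) j x = gam (B n M \<otimes> B n L) j y" for j
    by (rule all_from_period[OF eps_gam_shift(2)[OF x] eps_gam_shift(2)[OF y] gam])
  define b where "b j = fst x j * snd x j" for j
  define b' where "b' j = fst y j * snd y j" for j
  have b0: "b j \<noteq> 0" "b' j \<noteq> 0" for j using nz by (auto simp: b_def b'_def)
  have g: "b j / b (j + 1) = b' j / b' (j + 1)" for j
    using gam[of j] by (simp add: gam_BB_invariants b_def b'_def)
  have iff: "b' (j + 1) = b (j + 1) \<longleftrightarrow> b' j = b j" for j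
    using g[of j] b0[of j] b0[of "j + 1"] by (auto simp: field_simps)
  have bb: "b' j = b j" for j
  proof (induction j rule: int_induct[of _ k])
    case base
    then show ?case using k by (simp add: b_def b'_def)
  next
    case (step2 j)
    then show ?case using iff[of "j - 1"] by simp
  qed (use iff in auto)
  moreover have "1 / fst y i + 1 / snd y (i + 1) = 1 / fst x i + 1 / snd x (i + 1)" for i
    using eps[of i] bb[of "i + 1"] b0[of "i + 1"]
    unfolding eps_BB_invariants[OF x] eps_BB_invariants[OF y] b_def b'_def by simp
  ultimately show ?thesis by (simp add: same_invariants_def b_def b'_def)
qed

text \<open>
  Dominance of \<open>F\<close> and of the crystal operators makes the identities at \<open>x\<close>, at \<open>F x\<close> and at
  \<open>e\<^sub>1\<^sup>c x\<close> hold simultaneously for generic \<open>x\<close>.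
\<close>

lemma crystal_map_unique:
  assumes n: "n \<ge> 1" and L: "L > 0" "M > 0"
    and bir: "birational_map (B n L \<otimes> B n M) (B n M \<otimes> B n L) F"
    and comp: "crystal_compatible n (B n L \<otimes> B n M) (B n M \<otimes> B n L) F"
  shows "rational_eq (B n L \<otimes> B n M) F (R_explicit n)"
proof -
  let ?X = "B n L \<otimes> B n M" and ?Y = "B n M \<otimes> B n L"
  note conj = generically_conj[OF curve_connected_BB]
  have pts: "generically ?X (\<lambda>x. F x \<in> points ?Y)" and dom: "dominant ?X ?Y F"
    using bir by (auto simp: birational_map_def rational_map_def)
  have act: "generically ?X (\<lambda>x. act ?Y 1 c (F x) = F (act ?X 1 c x))" if "c \<noteq> 0" for c
    using comp n that by (auto simp: crystal_compatible_def rational_eq_def)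
  have eps: "generically ?X (\<lambda>x. eps ?X i x = eps ?Y i (F x))" 
    and gam: "generically ?X (\<lambda>x. gam ?X i x = gam ?Y i (F x))" if "i \<in> {0..int n}" for i
    using comp that by (auto simp: crystal_compatible_def rational_eq_def)
  have eps_act: "generically ?X (\<lambda>x. eps ?X 0 (act ?X 1 c x) = eps ?Y 0 (F (act ?X 1 c x)))" if "c \<noteq> 0" for c
    using generically_dominant[OF act_dominant[OF n that L] eps[of 0]] by simp
  have "generically ?X (\<lambda>x. F x \<in> points ?Y \<and> P_nonzero n x
    \<and> (\<forall>c\<in>{-1, 2}. act_regular 1 c x \<and> act_regular 1 c (F x) \<and> act ?Y 1 c (F x) = F (act ?X 1 c x)
        \<and> eps ?X 0 (act ?X 1 c x) = eps ?Y 0 (F (act ?X 1 c x)))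
    \<and> (\<forall>i\<in>{0..int n}. eps ?X i x = eps ?Y i (F x)) \<and> (\<forall>i\<in>{0..int n}. gam ?X i x = gam ?Y i (F x)))"
    by (intro conj generically_ball_finite[OF curve_connected_BB] pts generically_P_nonzero L
        generically_act_regular[OF n] generically_dominant[OF dom] act eps_act eps gam) auto
  then show ?thesis unfolding rational_eq_def
  proof (rule generically_mono, elim conjE)
    fix x assume x: "x \<in> points ?X" and y: "F x \<in> points ?Y" and P: "P_nonzero n x"
      and c: "\<forall>c\<in>{-1, 2}. act_regular 1 c x \<and> act_regular 1 c (F x) \<and> act ?Y 1 c (F x) = F (act ?X 1 c x)
        \<and> eps ?X 0 (act ?X 1 c x) = eps ?Y 0 (F (act ?X 1 c x))"
      and eps: "\<forall>i\<in>{0..int n}. eps ?X i x = eps ?Y i (F x)"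
      and gam: "\<forall>i\<in>{0..int n}. gam ?X i x = gam ?Y i (F x)"
    have e01: "eps ?X 0 x = eps ?Y 0 (F x)" "eps ?X 1 x = eps ?Y 1 (F x)" using eps n by auto
    have "fst (F x) 2 * snd (F x) 2 = fst x 2 * snd x 2"
      using product_from_eps[OF n x, of 1] product_from_eps[OF n y, of 1] c e01 by simp
    then have "same_invariants x (F x)" by (rule same_invariantsI[OF x y eps gam])
    then show "F x = R_explicit n x" by (rule R_explicit_eqI[OF x P y])
  qed
qed

theorem proposition7p3:
  fixes n :: nat and L M :: real
  assumes "n \<ge> 1" and "L > 0" and "M > 0"
  shows "tropical_R_map n L M (R_explicit n) \<and>
    (\<forall>R'. tropical_R_map n L M R' \<longrightarrow> rational_eq (B n L \<otimes> B n M) R' (R_explicit n))"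
proof (intro conjI allI impI)
  have "tropical_R_family n (\<lambda>_ _. R_explicit n)"
    unfolding tropical_R_family_def
    using R_explicit_birational R_explicit_crystal_compatible[OF assms(1)] R_explicit_yang_baxter
    by simp
  then show "tropical_R_map n L M (R_explicit n)" unfolding tropical_R_map_def by blast
next
  fix R' assume "tropical_R_map n L M R'"
  then show "rational_eq (B n L \<otimes> B n M) R' (R_explicit n)"
    using crystal_map_unique[OF assms] assms
    unfolding tropical_R_map_def tropical_R_family_def by blast
qed

end
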